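(* Let $\alpha>0$ and let $X=(X_t)_{t\in\mathbb{R}}$ be a two-sided real-valued Lévy process which is not a deterministic linear drift and which satisfies $\mathbb{E}[|X_1|]<\infty$ and $|\mathbb{E}[X_1]|<\alpha$. Let $M$ be the $\alpha$-Lipschitz minorant of $X$, and suppose that the contact set $\mathcal{Z}=\{t\in\mathbb{R}:M_t=X_t\wedge X_{t-}\}$ is almost surely discrete. Let $G=\sup(\mathcal{Z}\cap(-\infty,0))$, $D=\inf(\mathcal{Z}\cap(0,\infty))$, and define $$V_t=\begin{cases}X_D-X_{(D-t)-},&0\le t<\zeta_V,\\ \partial,&t\ge\zeta_V,\end{cases}\quad \zeta_V=D-G,\qquad W_t=\begin{cases}V_t,&0\le t<\zeta_W,\\ \partial,&t\ge\zeta_W,\end{cases}\quad \zeta_W=D.$$ Then for all bounded measurable functions $f_1,\dots,f_n:\mathbb{R}\cup\{\partial\}\to\mathbb{R}$ that take the value $0$ at $\partial$ and all times $0\le t_1<\dots<t_n<t<\infty$, $$\mathbb{E}[f_1(V_{t_1})\cdots f_n(V_{t_n})\mathbf{1}\{t<\zeta_V\}]=\mathbb{E}[f_1(W_{t_1})\cdots f_n(W_{t_n})\mathbf{1}\{t<\zeta_W\}]+t\,\frac{\mathbb{E}[f_1(W_{t_1})\cdots f_n(W_{t_n})\mathbf{1}\{\zeta_W\in dt\}]}{dt}.$$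
   Context: A two-sided Lévy process is a real-valued process indexed by $\mathbb{R}$ with càdlàg paths, stationary independent increments and value $0$ at time $0$. "Not a deterministic linear drift" means that there is no $a\in\mathbb{R}$ with $X_t=at$ for all $t$. The conditions $\mathbb{E}[|X_1|]<\infty$, $|\mathbb{E}[X_1]|<\alpha$ ensure that almost surely the path of $X$ has an $\alpha$-Lipschitz minorant $M$, the greatest function with $M\le X$ and $|M_s-M_t|\le\alpha|s-t|$ for all $s,t$; explicitly $M_t=\inf\{X_s+\alpha|t-s|:s\in\mathbb{R}\}$. $\partial$ is an isolated cemetery state. The last fraction denotes the density at $t$, with respect to Lebesgue measure on $(t_n,\infty)$, of the finite signed measure $A\mapsto\mathbb{E}[f_1(W_{t_1})\cdots f_n(W_{t_n})\mathbf{1}\{\zeta_W\in A\}]$, taken in its right-continuous version, i.e. minus the right derivative at $t$ of $s\mapsto\mathbb{E}[f_1(W_{t_1})\cdots f_n(W_{t_n})\mathbf{1}\{s<\zeta_W\}]$. *)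

theory Defs
  imports "HOL-Probability.Probability"
begin

definition cadlag :: "(real \<Rightarrow> real) \<Rightarrow> bool" where
  "cadlag x \<longleftrightarrow> (\<forall>t. continuous (at_right t) x \<and> (\<exists>l. (x \<longlongrightarrow> l) (at_left t)))"

(* Independence of the increments over {t 0 <= ... <= t n}: the sequence t matters only up to
   index n, so any finite increasing tuple of times is covered. *)
locale two_sided_levy_process = prob_space P
  for P :: "'a measure" and X :: "real \<Rightarrow> 'a \<Rightarrow> real" +
  assumes measurable_X: "\<And>t. X t \<in> borel_measurable P"
    and cadlag_paths: "\<And>\<omega>. \<omega> \<in> space P \<Longrightarrow> cadlag (\<lambda>t. X t \<omega>)"
    and zero_at_0: "\<And>\<omega>. \<omega> \<in> space P \<Longrightarrow> X 0 \<omega> = 0"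
    and stationary_increments:
      "\<And>s t h. s \<le> t \<Longrightarrow> distr P borel (\<lambda>\<omega>. X (t + h) \<omega> - X (s + h) \<omega>)
                        = distr P borel (\<lambda>\<omega>. X t \<omega> - X s \<omega>)"
    and independent_increments:
      "\<And>(n::nat) (t :: nat \<Rightarrow> real). mono t \<Longrightarrow>
         indep_vars (\<lambda>_. borel) (\<lambda>i \<omega>. X (t (Suc i)) \<omega> - X (t i) \<omega>) {..<n}"

definition left_lim :: "(real \<Rightarrow> real) \<Rightarrow> real \<Rightarrow> real" where
  "left_lim x t = Lim (at_left t) x"

(* Extended-real valued: a path without an alpha-Lipschitz function below it gets the value
   -infinity everywhere, and hence an empty contact set. *)
definition lipschitz_minorant :: "real \<Rightarrow> (real \<Rightarrow> real) \<Rightarrow> real \<Rightarrow> ereal" where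
  "lipschitz_minorant \<alpha> x t = (INF s. ereal (x s + \<alpha> * \<bar>t - s\<bar>))"

lemma lipschitz_minorant_greatest:
  assumes m0: "\<alpha>-lipschitz_on UNIV m0" "\<And>s. m0 s \<le> x s"
  obtains m where "\<And>t. lipschitz_minorant \<alpha> x t = ereal (m t)"
    and "\<alpha>-lipschitz_on UNIV m" and "\<And>t. m t \<le> x t"
    and "\<And>m' t. \<alpha>-lipschitz_on UNIV m' \<Longrightarrow> (\<And>s. m' s \<le> x s) \<Longrightarrow> m' t \<le> m t"
proof -
  have \<alpha>: "0 \<le> \<alpha>" using m0(1) by (rule lipschitz_on_nonneg)
  have below: "ereal (m' t) \<le> lipschitz_minorant \<alpha> x t"
    if "\<alpha>-lipschitz_on UNIV m'" "\<And>s. m' s \<le> x s" for m' t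
    unfolding lipschitz_minorant_def
  proof (rule INF_greatest)
    fix s
    have "\<bar>m' t - m' s\<bar> \<le> \<alpha> * \<bar>t - s\<bar>"
      using lipschitz_onD[OF that(1), of t s] by (simp add: dist_real_def)
    with that(2)[of s] show "ereal (m' t) \<le> ereal (x s + \<alpha> * \<bar>t - s\<bar>)"
      by simp
  qed
  have above: "lipschitz_minorant \<alpha> x t \<le> ereal (x s + \<alpha> * \<bar>t - s\<bar>)" for s t
    unfolding lipschitz_minorant_def by (rule INF_lower) simp
  define m where "m t = real_of_ereal (lipschitz_minorant \<alpha> x t)" for t
  have m: "lipschitz_minorant \<alpha> x t = ereal (m t)" for t
    using below[OF m0, of t] above[of t t] unfolding m_def
    by (cases "lipschitz_minorant \<alpha> x t") auto
  have le: "m t \<le> m u + \<alpha> * \<bar>t - u\<bar>" for t u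
  proof -
    have "ereal (m t - \<alpha> * \<bar>t - u\<bar>) \<le> lipschitz_minorant \<alpha> x u"
      unfolding lipschitz_minorant_def
    proof (rule INF_greatest)
      fix s
      have "m t \<le> x s + \<alpha> * \<bar>t - s\<bar>" using above[of t s] m by simp
      moreover have "\<alpha> * \<bar>t - s\<bar> \<le> \<alpha> * (\<bar>t - u\<bar> + \<bar>u - s\<bar>)"
        using \<alpha> by (intro mult_left_mono) auto
      ultimately show "ereal (m t - \<alpha> * \<bar>t - u\<bar>) \<le> ereal (x s + \<alpha> * \<bar>u - s\<bar>)"
        by (simp add: algebra_simps)
    qed
    then show ?thesis using m by simp
  qed
  have "\<alpha>-lipschitz_on UNIV m"
  proof (rule lipschitz_onI)
    fix t u :: real
    show "dist (m t) (m u) \<le> \<alpha> * dist t u"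
      using le[of t u] le[of u t] by (simp add: dist_real_def abs_minus_commute)
  qed (rule \<alpha>)
  moreover have "m t \<le> x t" for t using above[of t t] m by simp
  moreover have "m' t \<le> m t" if "\<alpha>-lipschitz_on UNIV m'" "\<And>s. m' s \<le> x s" for m' t
    using below[OF that, of t] m by simp
  ultimately show thesis using that m by blast
qed

definition contact_set :: "real \<Rightarrow> (real \<Rightarrow> real) \<Rightarrow> real set" where
  "contact_set \<alpha> x = {t. lipschitz_minorant \<alpha> x t = ereal (min (x t) (left_lim x t))}"

(* Real Sup and Inf: under the standing assumptions the contact set meets both half-lines almost
   surely; the (unspecified) values on the remaining paths are irrelevant. *)
definition contact_G :: "real \<Rightarrow> (real \<Rightarrow> real) \<Rightarrow> real" where
  "contact_G \<alpha> x = Sup (contact_set \<alpha> x \<inter> {..<0})"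

definition contact_D :: "real \<Rightarrow> (real \<Rightarrow> real) \<Rightarrow> real" where
  "contact_D \<alpha> x = Inf (contact_set \<alpha> x \<inter> {0<..})"

definition zeta_V :: "real \<Rightarrow> (real \<Rightarrow> real) \<Rightarrow> real" where
  "zeta_V \<alpha> x = contact_D \<alpha> x - contact_G \<alpha> x"

definition zeta_W :: "real \<Rightarrow> (real \<Rightarrow> real) \<Rightarrow> real" where
  "zeta_W \<alpha> x = contact_D \<alpha> x"

(* The state space is the reals with the cemetery adjoined; None is the cemetery.
   Both processes are only meant to be evaluated at times t >= 0. *)
definition process_V :: "real \<Rightarrow> (real \<Rightarrow> real) \<Rightarrow> real \<Rightarrow> real option" where
  "process_V \<alpha> x t =
     (if t < zeta_V \<alpha> x
      then Some (x (contact_D \<alpha> x) - left_lim x (contact_D \<alpha> x - t)) else None)"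

definition process_W :: "real \<Rightarrow> (real \<Rightarrow> real) \<Rightarrow> real \<Rightarrow> real option" where
  "process_W \<alpha> x t = (if t < zeta_W \<alpha> x then process_V \<alpha> x t else None)"

(* Borel sigma-algebra of the reals with an isolated point adjoined. *)
definition borel_cemetery :: "real option measure" where
  "borel_cemetery = sigma UNIV {A. Some -` A \<in> sets borel}"

(* g is a right-continuous version, on (a, infinity), of the Lebesgue density of the finite signed
   measure given by the set function mu. *)
definition right_cont_density_on :: "(real set \<Rightarrow> real) \<Rightarrow> real \<Rightarrow> (real \<Rightarrow> real) \<Rightarrow> bool" where
  "right_cont_density_on \<mu> a g \<longleftrightarrow>
     set_integrable lborel {a<..} g \<and>
     (\<forall>A\<in>sets borel. A \<subseteq> {a<..} \<longrightarrow> \<mu> A = (LINT s:A|lborel. g s)) \<and>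
     (\<forall>t>a. continuous (at_right t) g)"

end

theory Submission
  imports Defs
begin

text \<open>Let \<open>Z\<close> be the contact set and \<open>(G, D)\<close> the gap of \<open>Z\<close> that contains the origin. The process \<open>V\<close>
records the increments of the path backwards from \<open>D\<close> up to its lifetime \<open>D - G\<close>, so a
functional \<open>F\<close> of \<open>V\<close> does not change when the origin is moved to another point of the same gap.
The law of the path does not change under such a move either, because the increments are
stationary. Hence, given \<open>V\<close>, the origin sits in the gap like a uniformly distributed point. The
precise form is the mass transport identity \<open>E[F 1\<^sub>A(D)] = E[F / \<zeta> \<cdot> |A \<inter> (0, \<zeta>)|]\<close>, where
\<open>\<zeta> = D - G\<close>, for Borel sets \<open>A\<close> of positive numbers (lemmas \<open>mass_transport\<close> and
\<open>mass_transport_real\<close>). It is proved by letting the origin send the mass \<open>F 1\<^sub>A(D) / \<zeta>\<close> per unit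
length to every point of its gap: the mean mass sent equals the mean mass received.

The theorem follows from this identity. By Fubini the right-hand side is the integral over \<open>A\<close>
of \<open>g(r) = E[F / \<zeta>; r < \<zeta>]\<close>, so \<open>g\<close> is the required density; dominated convergence makes it
right-continuous on the positive half-line. The case \<open>A = (t, \<infinity>)\<close> and the decomposition
\<open>F = F (\<zeta> - t) / \<zeta> + t F / \<zeta>\<close> on \<open>{t < \<zeta>}\<close> give the formula (lemma \<open>expectation_long_gap\<close>).

Two facts make the gap of the origin well defined almost surely. First, \<open>Z\<close> is closed and
unbounded in both directions as soon as the path stays below \<open>\<beta> |s| + K\<close> in absolute value for
some \<open>\<beta> < \<alpha>\<close> (lemma \<open>two_sided_contact_set\<close>). The linear bound is a weak form of the strong law
of large numbers: a random walk with positive mean is bounded below, by Garsia's proof of the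
maximal ergodic inequality (lemma \<open>AE_not_run_unbounded\<close>), and Ottaviani's inequality extends
this from integer to dyadic times (lemma \<open>ottaviani\<close>). Second, the origin is not in \<open>Z\<close>: a
closed discrete set is countable, thus Lebesgue null, and by stationarity every time has the
same probability of being a contact time (lemma \<open>AE_0_not_contact\<close>).

All functionals are measurable on the space of cadlag paths with the coordinate sigma-algebra.
For \<open>D\<close> and \<open>G\<close> this is not obvious, since they are defined through uncountably many times;
lemma \<open>contact_hits_Icc\<close> reduces the question to rational times.\<close>

section \<open>Cadlag paths\<close>

lemma cadlag_right: "cadlag x \<Longrightarrow> (x \<longlongrightarrow> x t) (at_right t)"
  by (simp add: cadlag_def continuous_within)

lemma cadlag_left:
  assumes "cadlag x" shows "(x \<longlongrightarrow> left_lim x t) (at_left t)"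
proof -
  obtain l where "(x \<longlongrightarrow> l) (at_left t)" using assms by (auto simp: cadlag_def)
  moreover from this have "left_lim x t = l"
    unfolding left_lim_def by (intro tendsto_Lim) auto
  ultimately show ?thesis by simp
qed

lemma left_lim_eq: "(x \<longlongrightarrow> l) (at_left t) \<Longrightarrow> left_lim x t = l"
  unfolding left_lim_def by (intro tendsto_Lim) auto

text \<open>The value that the minorant has to meet at a contact point. For a cadlag path it is the largest
lower semicontinuous function below the path, which is why limits of contact points are contact points.\<close>
definition lower_value :: "(real \<Rightarrow> real) \<Rightarrow> real \<Rightarrow> real" where
  "lower_value x t = min (x t) (left_lim x t)"

lemma lower_value_le: "lower_value x t \<le> x t"
  by (simp add: lower_value_def)

text \<open>Near \<open>t\<close> the path takes values close to its right or to its left limit at \<open>t\<close>, hence not far below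
the smaller of the two.\<close>
lemma lower_value_less_nearby:
  assumes "cadlag x" "e > 0"
  shows "\<forall>\<^sub>F r in nhds t. lower_value x t - e < x r"
proof -
  have "\<forall>\<^sub>F r in at_right t. lower_value x t - e < x r"
    using cadlag_right[OF assms(1), of t] assms(2)
    by (intro order_tendstoD(1)[of _ "x t"]) (auto simp: lower_value_def)
  moreover have "\<forall>\<^sub>F r in at_left t. lower_value x t - e < x r"
    using cadlag_left[OF assms(1), of t] assms(2)
    by (intro order_tendstoD(1)[of _ "left_lim x t"]) (auto simp: lower_value_def)
  ultimately have "\<forall>\<^sub>F r in at t. lower_value x t - e < x r"
    by (simp add: eventually_at_split)
  then have "\<forall>\<^sub>F r in nhds t. r \<noteq> t \<longrightarrow> lower_value x t - e < x r"
    by (simp add: eventually_at_filter)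
  then show ?thesis
    by eventually_elim (use lower_value_le[of x t] assms(2) in force)
qed

lemma lower_value_lower_semicontinuous:
  assumes x: "cadlag x" and "e > 0"
  shows "\<forall>\<^sub>F r in nhds t. lower_value x t - e < lower_value x r"
proof -
  have "\<forall>\<^sub>F r in nhds t. lower_value x t - e / 2 < x r"
    using lower_value_less_nearby[OF x, of "e/2" t] \<open>e > 0\<close> by simp
  then have "\<forall>\<^sub>F r in nhds t. \<forall>\<^sub>F s in nhds r. lower_value x t - e / 2 < x s"
    by (simp add: eventually_eventually)
  then show ?thesis
  proof (rule eventually_mono)
    fix r assume r: "\<forall>\<^sub>F s in nhds r. lower_value x t - e / 2 < x s"
    have 1: "lower_value x t - e / 2 < x r" using eventually_nhds_x_imp_x[OF r] .
    have "\<forall>\<^sub>F s in at_left r. lower_value x t - e / 2 < x s"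
      using r by (auto simp: eventually_at_filter elim: eventually_mono)
    then have "\<forall>\<^sub>F s in at_left r. lower_value x t - e / 2 \<le> x s"
      by eventually_elim simp
    then have "lower_value x t - e / 2 \<le> left_lim x r"
      by (intro tendsto_lowerbound[OF cadlag_left[OF x]]) auto
    with 1 show "lower_value x t - e < lower_value x r"
      using \<open>e > 0\<close> by (auto simp: lower_value_def)
  qed
qed

text \<open>The one-sided limits give a bound near each point; compactness makes finitely many of them suffice.\<close>
lemma cadlag_bounded:
  assumes x: "cadlag x"
  shows "\<exists>B. \<forall>t\<in>{a..b}. \<bar>x t\<bar> \<le> B"
proof -
  have loc: "\<exists>B U. open U \<and> t \<in> U \<and> (\<forall>r\<in>U. \<bar>x r\<bar> \<le> B)" for t
  proof -
    define B where "B = \<bar>x t\<bar> + \<bar>left_lim x t\<bar> + 1"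
    have "\<forall>\<^sub>F r in at_right t. \<bar>x r\<bar> < B"
      using order_tendstoD(2)[OF tendsto_rabs[OF cadlag_right[OF x]], of t B] by (auto simp: B_def)
    moreover have "\<forall>\<^sub>F r in at_left t. \<bar>x r\<bar> < B"
      using order_tendstoD(2)[OF tendsto_rabs[OF cadlag_left[OF x]], of t B] by (auto simp: B_def)
    ultimately have "\<forall>\<^sub>F r in at t. \<bar>x r\<bar> < B"
      by (simp add: eventually_at_split)
    then have "\<forall>\<^sub>F r in nhds t. r \<noteq> t \<longrightarrow> \<bar>x r\<bar> < B"
      by (simp add: eventually_at_filter)
    then have "\<forall>\<^sub>F r in nhds t. \<bar>x r\<bar> \<le> B"
      by eventually_elim (auto simp: B_def)
    then show ?thesis unfolding eventually_nhds by blast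
  qed
  then obtain B U where BU: "\<And>t. open (U t)" "\<And>t. t \<in> U t" "\<And>t r. r \<in> U t \<Longrightarrow> \<bar>x r\<bar> \<le> B t"
    by metis
  obtain C where C: "C \<subseteq> {a..b}" "finite C" "{a..b} \<subseteq> (\<Union>t\<in>C. U t)"
    using compactE_image[of "{a..b}" "{a..b}" U] BU by (metis UN_I compact_Icc subsetI)
  show ?thesis
  proof (intro exI ballI)
    fix t assume "t \<in> {a..b}"
    then obtain c where "c \<in> C" "t \<in> U c" using C by auto
    then have "\<bar>x t\<bar> \<le> B c" "\<bar>B c\<bar> \<le> (\<Sum>c\<in>C. \<bar>B c\<bar>)"
      using BU C by (auto intro!: member_le_sum)
    then show "\<bar>x t\<bar> \<le> (\<Sum>c\<in>C. \<bar>B c\<bar>)" by simp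
  qed
qed

text \<open>Both approximations are strict: \<open>\<lfloor>\<cdot>\<rfloor> + 1\<close> and \<open>\<lceil>\<cdot>\<rceil> - 1\<close> are used instead of \<open>\<lceil>\<cdot>\<rceil>\<close> and \<open>\<lfloor>\<cdot>\<rfloor>\<close>
so that a dyadic \<open>t\<close> is also approached from one side, as one-sided limits require.\<close>
definition dyadic_above :: "nat \<Rightarrow> real \<Rightarrow> real" where
  "dyadic_above k t = (of_int \<lfloor>2 ^ k * t\<rfloor> + 1) / 2 ^ k"

definition dyadic_below :: "nat \<Rightarrow> real \<Rightarrow> real" where
  "dyadic_below k t = (of_int \<lceil>2 ^ k * t\<rceil> - 1) / 2 ^ k"

lemma inverse_power2_tendsto: "(\<lambda>k. 1 / 2 ^ k :: real) \<longlonglongrightarrow> 0"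
  using LIMSEQ_power_zero[of "1/2::real"] by (simp add: power_one_over)

lemma dyadic_above: "t < dyadic_above k t" "dyadic_above k t \<le> t + 1 / 2 ^ k"
proof -
  have "2 ^ k * t < of_int \<lfloor>2 ^ k * t\<rfloor> + 1" "of_int \<lfloor>2 ^ k * t\<rfloor> + 1 \<le> 2 ^ k * t + 1" by linarith+
  then show "t < dyadic_above k t" "dyadic_above k t \<le> t + 1 / 2 ^ k"
    by (simp_all add: dyadic_above_def field_simps)
qed

lemma dyadic_below: "dyadic_below k t < t" "t - 1 / 2 ^ k \<le> dyadic_below k t"
proof -
  have "of_int \<lceil>2 ^ k * t\<rceil> - 1 < 2 ^ k * t" "2 ^ k * t - 1 \<le> of_int \<lceil>2 ^ k * t\<rceil> - 1" by linarith+
  then show "dyadic_below k t < t" "t - 1 / 2 ^ k \<le> dyadic_below k t"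
    by (simp_all add: dyadic_below_def field_simps)
qed

lemma dyadic_above_tendsto: "filterlim (\<lambda>k. dyadic_above k t) (at_right t) sequentially"
proof (rule tendsto_imp_filterlim_at_right)
  have "(\<lambda>k. t + 1 / 2 ^ k) \<longlonglongrightarrow> t + 0"
    by (intro tendsto_intros inverse_power2_tendsto)
  then show "(\<lambda>k. dyadic_above k t) \<longlonglongrightarrow> t"
    by (intro tendsto_sandwich[OF _ _ tendsto_const, of t "\<lambda>k. dyadic_above k t" _ "\<lambda>k. t + 1 / 2 ^ k"])
       (auto intro!: always_eventually simp: dyadic_above less_imp_le)
qed (simp add: dyadic_above)

lemma dyadic_below_tendsto: "filterlim (\<lambda>k. dyadic_below k t) (at_left t) sequentially"
proof (rule tendsto_imp_filterlim_at_left)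
  have "(\<lambda>k. t - 1 / 2 ^ k) \<longlonglongrightarrow> t - 0"
    by (intro tendsto_intros inverse_power2_tendsto)
  then show "(\<lambda>k. dyadic_below k t) \<longlonglongrightarrow> t"
    by (intro tendsto_sandwich[OF _ _ _ tendsto_const, of "\<lambda>k. t - 1 / 2 ^ k" "\<lambda>k. dyadic_below k t" _ t])
       (auto intro!: always_eventually simp: dyadic_below less_imp_le)
qed (simp add: dyadic_below)

lemma cadlag_dyadic_above: "cadlag x \<Longrightarrow> (\<lambda>k. x (dyadic_above k t)) \<longlonglongrightarrow> x t"
  by (rule filterlim_compose[OF cadlag_right dyadic_above_tendsto])

lemma cadlag_dyadic_below: "cadlag x \<Longrightarrow> (\<lambda>k. x (dyadic_below k t)) \<longlonglongrightarrow> left_lim x t"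
  by (rule filterlim_compose[OF cadlag_left dyadic_below_tendsto])

lemma dyadic_rat: "dyadic_above k t \<in> \<rat>" "dyadic_below k t \<in> \<rat>"
  by (auto simp: dyadic_above_def dyadic_below_def)

text \<open>The path seen from \<open>(u, x u)\<close> as the new origin.\<close>
definition shift_path :: "real \<Rightarrow> (real \<Rightarrow> real) \<Rightarrow> real \<Rightarrow> real" where
  "shift_path u x t = x (t + u) - x u"

lemma tendsto_shift:
  fixes x :: "real \<Rightarrow> real"
  shows "((\<lambda>t. x (t + u)) \<longlongrightarrow> l) (at_right t) \<longleftrightarrow> (x \<longlongrightarrow> l) (at_right (t + u))"
    and "((\<lambda>t. x (t + u)) \<longlongrightarrow> l) (at_left t) \<longleftrightarrow> (x \<longlongrightarrow> l) (at_left (t + u))"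
proof -
  have "at_right (t + u) = filtermap (\<lambda>t. t + u) (at_right t)"
    using filtermap_at_right_shift[of "-u" t] by simp
  then show "((\<lambda>t. x (t + u)) \<longlongrightarrow> l) (at_right t) \<longleftrightarrow> (x \<longlongrightarrow> l) (at_right (t + u))"
    by (simp add: filterlim_def filtermap_filtermap)
  have "at_left (t + u) = filtermap (\<lambda>t. t + u) (at_left t)"
    using filtermap_at_left_shift[of "-u" t] by simp
  then show "((\<lambda>t. x (t + u)) \<longlongrightarrow> l) (at_left t) \<longleftrightarrow> (x \<longlongrightarrow> l) (at_left (t + u))"
    by (simp add: filterlim_def filtermap_filtermap)
qed

lemma shift_left: "cadlag x \<Longrightarrow> (shift_path u x \<longlongrightarrow> left_lim x (t + u) - x u) (at_left t)"
  unfolding shift_path_def by (intro tendsto_intros tendsto_shift(2)[THEN iffD2] cadlag_left)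

lemma cadlag_shift:
  assumes "cadlag x" shows "cadlag (shift_path u x)"
  unfolding cadlag_def continuous_within
proof (intro allI conjI)
  fix t
  show "(shift_path u x \<longlongrightarrow> shift_path u x t) (at_right t)"
    unfolding shift_path_def
    by (intro tendsto_intros tendsto_shift(1)[THEN iffD2] cadlag_right assms)
qed (use shift_left[OF assms] in blast)

lemma left_lim_shift: "cadlag x \<Longrightarrow> left_lim (shift_path u x) t = left_lim x (t + u) - x u"
  by (intro left_lim_eq shift_left)

lemma lower_value_shift: "cadlag x \<Longrightarrow> lower_value (shift_path u x) t = lower_value x (t + u) - x u"
  by (simp add: lower_value_def left_lim_shift) (simp add: shift_path_def min_def)

section \<open>Contact points\<close>

text \<open>The minorant at \<open>t\<close> never exceeds the lower value there, so \<open>t\<close> is a contact point exactly when the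
lower value is one of the lower bounds whose infimum defines the minorant. Neither the minorant nor the
question whether it is finite appears any more.\<close>
lemma contact_set_iff:
  assumes x: "cadlag x"
  shows "t \<in> contact_set \<alpha> x \<longleftrightarrow> (\<forall>s. lower_value x t \<le> x s + \<alpha> * \<bar>t - s\<bar>)"
proof
  assume "t \<in> contact_set \<alpha> x"
  then have eq: "(INF s. ereal (x s + \<alpha> * \<bar>t - s\<bar>)) = ereal (lower_value x t)"
    by (simp add: contact_set_def lipschitz_minorant_def lower_value_def)
  show "\<forall>s. lower_value x t \<le> x s + \<alpha> * \<bar>t - s\<bar>"
  proof
    fix s
    have "(INF s. ereal (x s + \<alpha> * \<bar>t - s\<bar>)) \<le> ereal (x s + \<alpha> * \<bar>t - s\<bar>)"
      by (rule INF_lower) simp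
    then show "lower_value x t \<le> x s + \<alpha> * \<bar>t - s\<bar>" unfolding eq by simp
  qed
next
  assume *: "\<forall>s. lower_value x t \<le> x s + \<alpha> * \<bar>t - s\<bar>"
  let ?m = "INF s. ereal (x s + \<alpha> * \<bar>t - s\<bar>)"
  have "?m \<le> ereal (x t + \<alpha> * \<bar>t - t\<bar>)" by (rule INF_lower) simp
  moreover have "?m \<le> ereal (left_lim x t)"
  proof (rule tendsto_lowerbound)
    have "((\<lambda>s. x s + \<alpha> * \<bar>t - s\<bar>) \<longlongrightarrow> left_lim x t + \<alpha> * \<bar>t - t\<bar>) (at_left t)"
      by (intro tendsto_intros cadlag_left x)
    then show "((\<lambda>s. ereal (x s + \<alpha> * \<bar>t - s\<bar>)) \<longlongrightarrow> ereal (left_lim x t)) (at_left t)"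
      by simp
    show "\<forall>\<^sub>F s in at_left t. ?m \<le> ereal (x s + \<alpha> * \<bar>t - s\<bar>)"
      by (intro always_eventually allI INF_lower) simp
  qed simp
  ultimately have "?m \<le> ereal (lower_value x t)" by (simp add: lower_value_def)
  moreover have "ereal (lower_value x t) \<le> ?m" using * by (intro INF_greatest) simp
  ultimately have "?m = ereal (lower_value x t)" by (rule antisym)
  then show "t \<in> contact_set \<alpha> x"
    by (simp add: contact_set_def lipschitz_minorant_def lower_value_def)
qed

text \<open>Right-continuity extends the inequality from rational to all times.\<close>
lemma contact_set_iff_rat:
  assumes x: "cadlag x"
  shows "t \<in> contact_set \<alpha> x \<longleftrightarrow> (\<forall>s\<in>\<rat>. lower_value x t \<le> x s + \<alpha> * \<bar>t - s\<bar>)"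
proof
  assume *: "\<forall>s\<in>\<rat>. lower_value x t \<le> x s + \<alpha> * \<bar>t - s\<bar>"
  have "lower_value x t \<le> x s + \<alpha> * \<bar>t - s\<bar>" for s
  proof (rule tendsto_lowerbound)
    show "(\<lambda>k. x (dyadic_above k s) + \<alpha> * \<bar>t - dyadic_above k s\<bar>) \<longlonglongrightarrow> x s + \<alpha> * \<bar>t - s\<bar>"
      using dyadic_above_tendsto[of s]
      by (intro tendsto_add tendsto_mult tendsto_rabs tendsto_diff tendsto_const
            cadlag_dyadic_above[OF x]) (simp add: filterlim_at)
  qed (use * dyadic_rat in auto)
  then show "t \<in> contact_set \<alpha> x" by (simp add: contact_set_iff[OF x])
qed (simp add: contact_set_iff[OF x])

text \<open>The left-hand side of the inequalities that characterise contact is lower semicontinuous in \<open>t\<close> and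
the right-hand side is continuous.\<close>
lemma closed_contact_set:
  assumes x: "cadlag x"
  shows "closed (contact_set \<alpha> x)"
  unfolding closed_sequential_limits
proof (intro allI impI, elim conjE)
  fix u t assume "\<forall>n. u n \<in> contact_set \<alpha> x" "u \<longlonglongrightarrow> t"
  then have u: "\<And>n. u n \<in> contact_set \<alpha> x" "u \<longlonglongrightarrow> t" by auto
  have lsc: "lower_value x t - e \<le> x s + \<alpha> * \<bar>t - s\<bar>" if "e > 0" for s e
  proof (rule tendsto_lowerbound)
    show "(\<lambda>n. x s + \<alpha> * \<bar>u n - s\<bar>) \<longlonglongrightarrow> x s + \<alpha> * \<bar>t - s\<bar>"
      by (intro tendsto_intros u)
    have "\<forall>\<^sub>F n in sequentially. lower_value x t - e < lower_value x (u n)"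
      using lower_value_lower_semicontinuous[OF x that] u(2) by (rule eventually_compose_filterlim)
    then show "\<forall>\<^sub>F n in sequentially. lower_value x t - e \<le> x s + \<alpha> * \<bar>u n - s\<bar>"
    proof eventually_elim
      case (elim n)
      have "lower_value x (u n) \<le> x s + \<alpha> * \<bar>u n - s\<bar>" using u(1) by (simp add: contact_set_iff[OF x])
      with elim show ?case by simp
    qed
  qed simp
  have "lower_value x t \<le> x s + \<alpha> * \<bar>t - s\<bar>" for s
  proof (rule field_le_epsilon)
    show "lower_value x t \<le> x s + \<alpha> * \<bar>t - s\<bar> + e" if "e > 0" for e
      using lsc[OF that, of s] by simp
  qed
  then show "t \<in> contact_set \<alpha> x" by (simp add: contact_set_iff[OF x])
qed

lemma contact_set_shift:
  assumes x: "cadlag x"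
  shows "t \<in> contact_set \<alpha> (shift_path u x) \<longleftrightarrow> t + u \<in> contact_set \<alpha> x"
proof -
  have "(\<forall>s. lower_value x (t + u) \<le> x (s + u) + \<alpha> * \<bar>t - s\<bar>)
     \<longleftrightarrow> (\<forall>s. lower_value x (t + u) \<le> x s + \<alpha> * \<bar>t + u - s\<bar>)"
    (is "?L \<longleftrightarrow> ?R")
  proof
    show "?R" if ?L
    proof
      fix s show "lower_value x (t + u) \<le> x s + \<alpha> * \<bar>t + u - s\<bar>"
        using that[rule_format, of "s - u"] by (simp add: algebra_simps)
    qed
    show "?L" if ?R
    proof
      fix s show "lower_value x (t + u) \<le> x (s + u) + \<alpha> * \<bar>t - s\<bar>"
        using that[rule_format, of "s + u"] by simp
    qed
  qed
  then show ?thesis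
    by (simp add: contact_set_iff x cadlag_shift lower_value_shift) (simp add: shift_path_def)
qed

text \<open>The growth condition makes \<open>r \<mapsto> x r + \<alpha> |t - r|\<close> coercive, so its infimum is attained if \<open>x\<close> is
replaced by its lower value at the minimizer. The triangle inequality turns a minimizer for \<open>t\<close> into a
minimizer for itself, that is, into a contact point.\<close>
lemma minimizer_is_contact:
  assumes x: "cadlag x" and \<beta>: "\<beta> < \<alpha>" "0 < \<alpha>" and bound: "\<And>s. - \<beta> * \<bar>s\<bar> - K \<le> x s"
  obtains s where "s \<in> contact_set \<alpha> x" "\<And>r. lower_value x s + \<alpha> * \<bar>t - s\<bar> \<le> x r + \<alpha> * \<bar>t - r\<bar>"
proof -
  define \<phi> where "\<phi> r = x r + \<alpha> * \<bar>t - r\<bar>" for r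
  have coercive: "(\<alpha> - \<beta>) * \<bar>r\<bar> \<le> \<phi> r + K + \<alpha> * \<bar>t\<bar>" for r
  proof -
    have "\<alpha> * \<bar>r\<bar> \<le> \<alpha> * (\<bar>t - r\<bar> + \<bar>t\<bar>)" using \<beta> by (intro mult_left_mono) auto
    then show ?thesis using bound[of r] by (simp add: \<phi>_def algebra_simps)
  qed
  have lower: "- (K + \<alpha> * \<bar>t\<bar>) \<le> \<phi> r" for r
    using coercive[of r] \<beta> mult_nonneg_nonneg[of "\<alpha> - \<beta>" "\<bar>r\<bar>"] by linarith
  then have bdd: "bdd_below (range \<phi>)" by (auto intro!: bdd_belowI)
  define m where "m = (INF r. \<phi> r)"
  have m_le: "m \<le> \<phi> r" for r unfolding m_def by (rule cINF_lower[OF bdd]) simp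
  have "\<exists>r. \<phi> r < m + 1 / real (Suc k)" for k
    using cINF_less_iff[OF _ bdd, of "m + 1 / real (Suc k)"] by (auto simp: m_def)
  then obtain r where r: "\<And>k. \<phi> (r k) < m + 1 / real (Suc k)" by metis
  have "\<bar>r k\<bar> \<le> (m + 1 + K + \<alpha> * \<bar>t\<bar>) / (\<alpha> - \<beta>)" for k
  proof -
    have "1 / real (Suc k) \<le> 1" by simp
    then have "(\<alpha> - \<beta>) * \<bar>r k\<bar> \<le> m + 1 + K + \<alpha> * \<bar>t\<bar>"
      using coercive[of "r k"] r[of k] by linarith
    then show ?thesis using \<beta> by (simp add: pos_le_divide_eq mult.commute)
  qed
  then have "\<forall>k. r k \<in> cball 0 ((m + 1 + K + \<alpha> * \<bar>t\<bar>) / (\<alpha> - \<beta>))" by simp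
  then obtain s \<sigma> where \<sigma>: "strict_mono \<sigma>" "(r \<circ> \<sigma>) \<longlonglongrightarrow> s"
    using compact_cball[unfolded compact_def] by meson
  have le: "lower_value x s + \<alpha> * \<bar>t - s\<bar> \<le> m"
  proof (rule field_le_epsilon)
    fix e :: real assume "e > 0"
    have "lower_value x s - e + \<alpha> * \<bar>t - s\<bar> \<le> m + 0"
    proof (rule tendsto_le)
      show "(\<lambda>k. lower_value x s - e + \<alpha> * \<bar>t - (r \<circ> \<sigma>) k\<bar>) \<longlonglongrightarrow> lower_value x s - e + \<alpha> * \<bar>t - s\<bar>"
        by (intro tendsto_intros \<sigma>)
      have "(\<lambda>k. 1 / real (Suc k)) \<longlonglongrightarrow> 0" by (rule LIMSEQ_Suc[OF lim_inverse_n'])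
      from LIMSEQ_subseq_LIMSEQ[OF this \<sigma>(1)]
      show "(\<lambda>k. m + 1 / real (Suc (\<sigma> k))) \<longlonglongrightarrow> m + 0" by (intro tendsto_intros) (simp add: o_def)
      have "\<forall>\<^sub>F k in sequentially. lower_value x s - e < x ((r \<circ> \<sigma>) k)"
        using lower_value_less_nearby[OF x \<open>e > 0\<close>] \<sigma>(2) by (rule eventually_compose_filterlim)
      then show "\<forall>\<^sub>F k in sequentially. lower_value x s - e + \<alpha> * \<bar>t - (r \<circ> \<sigma>) k\<bar> \<le> m + 1 / real (Suc (\<sigma> k))"
      proof eventually_elim
        case (elim k)
        then show ?case using r[of "\<sigma> k"] by (simp add: \<phi>_def del: of_nat_Suc)
      qed
    qed simp
    then show "lower_value x s + \<alpha> * \<bar>t - s\<bar> \<le> m + e" by simp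
  qed
  show thesis
  proof (rule that)
    show le': "lower_value x s + \<alpha> * \<bar>t - s\<bar> \<le> x r + \<alpha> * \<bar>t - r\<bar>" for r
      using le m_le[of r] by (simp add: \<phi>_def)
    have "lower_value x s \<le> x r + \<alpha> * \<bar>s - r\<bar>" for r
    proof -
      have "\<alpha> * \<bar>t - r\<bar> \<le> \<alpha> * (\<bar>t - s\<bar> + \<bar>s - r\<bar>)" using \<beta> by (intro mult_left_mono) auto
      then show ?thesis using le'[of r] by (simp add: algebra_simps)
    qed
    then show "s \<in> contact_set \<alpha> x" by (simp add: contact_set_iff[OF x])
  qed
qed

text \<open>The property of the contact set under which every point outside lies in a bounded open gap.\<close>
definition two_sided_closed :: "real set \<Rightarrow> bool" where
  "two_sided_closed Z \<longleftrightarrow> closed Z \<and> (\<forall>T. \<exists>s\<in>Z. T < s) \<and> (\<forall>T. \<exists>s\<in>Z. s < T)"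

text \<open>If \<open>s\<close> is a minimizer for the time \<open>t\<close>, then \<open>\<alpha> |t - s| \<le> \<beta> |t| + \<beta> |s| + 2 K\<close>, because the
minimum is at most \<open>x t\<close>. As \<open>\<beta> < \<alpha>\<close>, this forces \<open>s\<close> beyond any given bound on the side of \<open>t\<close>
when \<open>|t|\<close> is large.\<close>
lemma two_sided_contact_set:
  assumes x: "cadlag x" and \<beta>: "0 \<le> \<beta>" "\<beta> < \<alpha>" and bound: "\<And>s. \<bar>x s\<bar> \<le> \<beta> * \<bar>s\<bar> + K"
  shows "two_sided_closed (contact_set \<alpha> x)"
proof -
  have lb: "- \<beta> * \<bar>s\<bar> - K \<le> x s" for s using bound[of s] by (simp add: abs_le_iff)
  have llb: "- \<beta> * \<bar>s\<bar> - K \<le> lower_value x s" for s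
  proof -
    have "- \<beta> * \<bar>s\<bar> - K \<le> left_lim x s"
    proof (rule tendsto_le[OF _ cadlag_left[OF x]])
      show "((\<lambda>r. - \<beta> * \<bar>r\<bar> - K) \<longlongrightarrow> - \<beta> * \<bar>s\<bar> - K) (at_left s)" by (intro tendsto_intros)
    qed (use lb in auto)
    then show ?thesis using lb by (simp add: lower_value_def)
  qed
  have key: "\<exists>s\<in>contact_set \<alpha> x. (\<alpha> * \<bar>t - s\<bar> \<le> \<beta> * \<bar>t\<bar> + \<beta> * \<bar>s\<bar> + 2 * K)" for t
  proof -
    obtain s where s: "s \<in> contact_set \<alpha> x" "\<And>r. lower_value x s + \<alpha> * \<bar>t - s\<bar> \<le> x r + \<alpha> * \<bar>t - r\<bar>"
      using minimizer_is_contact[OF x \<beta>(2) _ lb, of t] \<beta> by auto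
    with s(2)[of t] llb[of s] bound[of t] show ?thesis by (intro bexI[of _ s]) auto
  qed
  \<comment> \<open>At such a time the inequality in \<open>key\<close> excludes minimizers on the near side of \<open>T\<close>.\<close>
  have far: "\<exists>t>0. \<beta> * t + 2 * \<alpha> * \<bar>T\<bar> + 2 * K < \<alpha> * t" for T
  proof -
    define c where "c = 2 * \<alpha> * \<bar>T\<bar> + 2 * \<bar>K\<bar>"
    define t where "t = c / (\<alpha> - \<beta>) + 1"
    have "0 \<le> c" using \<beta> by (simp add: c_def)
    then have "0 < t" using \<beta> by (auto simp: t_def intro!: add_nonneg_pos divide_nonneg_pos)
    moreover have "(\<alpha> - \<beta>) * t = c + (\<alpha> - \<beta>)"
      using \<beta> by (simp add: t_def distrib_left)
    then have "\<alpha> * t = \<beta> * t + c + (\<alpha> - \<beta>)" by (simp add: algebra_simps)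
    ultimately show ?thesis using \<beta> by (intro exI[of _ t]) (auto simp: c_def)
  qed
  have "\<exists>s\<in>contact_set \<alpha> x. T < s" for T
  proof -
    obtain t where t: "t > 0" "\<beta> * t + 2 * \<alpha> * \<bar>T\<bar> + 2 * K < \<alpha> * t" using far by blast
    obtain s where s: "s \<in> contact_set \<alpha> x" "\<alpha> * \<bar>t - s\<bar> \<le> \<beta> * \<bar>t\<bar> + \<beta> * \<bar>s\<bar> + 2 * K"
      using key by blast
    have "T < s"
    proof (rule ccontr)
      assume "\<not> T < s"
      have "\<alpha> * s + \<beta> * \<bar>s\<bar> \<le> 2 * \<alpha> * \<bar>T\<bar>"
      proof (cases "s \<ge> 0")
        case True
        then have "\<beta> * s \<le> \<alpha> * s" "\<alpha> * s \<le> \<alpha> * \<bar>T\<bar>" using \<beta> \<open>\<not> T < s\<close>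
          by (auto intro!: mult_right_mono mult_left_mono)
        then show ?thesis using True by simp
      next
        case False
        then have "\<alpha> * s \<le> \<beta> * s" using \<beta> by (intro mult_right_mono_neg) auto
        moreover have "0 \<le> \<alpha> * \<bar>T\<bar>" using \<beta> by simp
        moreover have "\<beta> * \<bar>s\<bar> = - (\<beta> * s)" using False by simp
        ultimately show ?thesis by linarith
      qed
      moreover have "\<alpha> * (t - s) \<le> \<alpha> * \<bar>t - s\<bar>" using \<beta> by (intro mult_left_mono) auto
      ultimately show False using s(2) t by (simp add: algebra_simps)
    qed
    with s show ?thesis by blast
  qed
  moreover have "\<exists>s\<in>contact_set \<alpha> x. s < T" for T
  proof -
    obtain t where t: "t > 0" "\<beta> * t + 2 * \<alpha> * \<bar>T\<bar> + 2 * K < \<alpha> * t" using far by blast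
    obtain s where s: "s \<in> contact_set \<alpha> x" "\<alpha> * \<bar>-t - s\<bar> \<le> \<beta> * \<bar>-t\<bar> + \<beta> * \<bar>s\<bar> + 2 * K"
      using key by blast
    have "s < T"
    proof (rule ccontr)
      assume "\<not> s < T"
      have "\<alpha> * (-s) + \<beta> * \<bar>s\<bar> \<le> 2 * \<alpha> * \<bar>T\<bar>"
      proof (cases "s \<le> 0")
        case True
        have s: "\<bar>s\<bar> = - s" "\<bar>s\<bar> \<le> \<bar>T\<bar>" using True \<open>\<not> s < T\<close> by auto
        have "\<beta> * \<bar>s\<bar> \<le> \<alpha> * \<bar>s\<bar>" by (rule mult_right_mono) (use \<beta> in auto)
        moreover have "\<alpha> * \<bar>s\<bar> \<le> \<alpha> * \<bar>T\<bar>" by (rule mult_left_mono) (use \<beta> s in auto)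
        ultimately show ?thesis unfolding s(1)[symmetric] by linarith
      next
        case False
        then have "\<beta> * s \<le> \<alpha> * s" using \<beta> by (intro mult_right_mono) auto
        moreover have "0 \<le> \<alpha> * \<bar>T\<bar>" using \<beta> by simp
        moreover have "\<beta> * \<bar>s\<bar> = \<beta> * s" using False by simp
        moreover have "\<alpha> * (-s) = - (\<alpha> * s)" by simp
        ultimately show ?thesis by linarith
      qed
      moreover have "\<alpha> * (t + s) \<le> \<alpha> * \<bar>-t - s\<bar>" using \<beta> by (intro mult_left_mono) auto
      ultimately show False using s(2) t by (simp add: algebra_simps)
    qed
    with s show ?thesis by blast
  qed
  ultimately show ?thesis by (simp add: two_sided_closed_def closed_contact_set x)
qed

section \<open>Gaps between contact points\<close>

definition prev_point :: "real set \<Rightarrow> real \<Rightarrow> real" where "prev_point Z a = Sup (Z \<inter> {..<a})"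
definition next_point :: "real set \<Rightarrow> real \<Rightarrow> real" where "next_point Z a = Inf (Z \<inter> {a<..})"

lemma next_point:
  assumes Z: "two_sided_closed Z" and a: "a \<notin> Z"
  shows "next_point Z a \<in> Z" "a < next_point Z a" "\<And>z. z \<in> Z \<Longrightarrow> a < z \<Longrightarrow> next_point Z a \<le> z"
proof -
  have eq: "Z \<inter> {a<..} = Z \<inter> {a..}" using a by (auto simp: less_le)
  have "closed (Z \<inter> {a<..})" unfolding eq using Z by (auto simp: two_sided_closed_def)
  moreover have "Z \<inter> {a<..} \<noteq> {}" using Z by (auto simp: two_sided_closed_def)
  moreover have bdd: "bdd_below (Z \<inter> {a<..})" by (rule bdd_belowI[of _ a]) auto
  ultimately have "next_point Z a \<in> Z \<inter> {a<..}"
    unfolding next_point_def by (intro closed_contains_Inf)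
  then show "next_point Z a \<in> Z" "a < next_point Z a" by auto
  show "next_point Z a \<le> z" if "z \<in> Z" "a < z" for z
    unfolding next_point_def using that bdd by (intro cInf_lower) auto
qed

lemma prev_point:
  assumes Z: "two_sided_closed Z" and a: "a \<notin> Z"
  shows "prev_point Z a \<in> Z" "prev_point Z a < a" "\<And>z. z \<in> Z \<Longrightarrow> z < a \<Longrightarrow> z \<le> prev_point Z a"
proof -
  have eq: "Z \<inter> {..<a} = Z \<inter> {..a}" using a by (auto simp: less_le)
  have "closed (Z \<inter> {..<a})" unfolding eq using Z by (auto simp: two_sided_closed_def)
  moreover have "Z \<inter> {..<a} \<noteq> {}" using Z by (auto simp: two_sided_closed_def)
  moreover have bdd: "bdd_above (Z \<inter> {..<a})" by (rule bdd_aboveI[of _ a]) auto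
  ultimately have "prev_point Z a \<in> Z \<inter> {..<a}"
    unfolding prev_point_def by (intro closed_contains_Sup)
  then show "prev_point Z a \<in> Z" "prev_point Z a < a" by auto
  show "z \<le> prev_point Z a" if "z \<in> Z" "z < a" for z
    unfolding prev_point_def using that bdd by (intro cSup_upper) auto
qed

text \<open>A point strictly between the neighbours of \<open>a\<close> has no element of \<open>Z\<close> between itself and \<open>a\<close>.\<close>
lemma same_gap:
  assumes Z: "two_sided_closed Z" and ab: "a \<notin> Z" "b \<notin> Z" and "prev_point Z a < b" "b < next_point Z a"
  shows "prev_point Z b = prev_point Z a" "next_point Z b = next_point Z a"
proof -
  note A = prev_point[OF Z ab(1)] next_point[OF Z ab(1)]
  note B = prev_point[OF Z ab(2)] next_point[OF Z ab(2)]
  show "prev_point Z b = prev_point Z a"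
  proof (rule antisym)
    show "prev_point Z b \<le> prev_point Z a"
      using A(3)[OF B(1)] A(6)[OF B(1)] B(2) assms(5) A(2) ab B(1) by (metis linorder_neqE_linordered_idom not_le order.strict_trans)
    show "prev_point Z a \<le> prev_point Z b" using B(3)[OF A(1)] assms(4) by simp
  qed
  show "next_point Z b = next_point Z a"
  proof (rule antisym)
    show "next_point Z b \<le> next_point Z a" using B(6)[OF A(4)] assms(5) by simp
    show "next_point Z a \<le> next_point Z b"
      using A(3)[OF B(4)] A(6)[OF B(4)] B(5) assms(4) A(2) ab B(4) by (metis linorder_neqE_linordered_idom not_le order.strict_trans)
  qed
qed

lemma contact_GD_shift:
  assumes x: "cadlag x" and Z: "two_sided_closed (contact_set \<alpha> x)"
  shows "contact_G \<alpha> (shift_path u x) = prev_point (contact_set \<alpha> x) u - u"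
    and "contact_D \<alpha> (shift_path u x) = next_point (contact_set \<alpha> x) u - u"
proof -
  let ?Z = "contact_set \<alpha> x"
  have G: "contact_set \<alpha> (shift_path u x) \<inter> {..<0} = (\<lambda>t. - u + t) ` (?Z \<inter> {..<u})"
    by (auto simp: contact_set_shift[OF x] image_iff intro!: bexI[of _ "_ + u"])
  have D: "contact_set \<alpha> (shift_path u x) \<inter> {0<..} = (\<lambda>t. - u + t) ` (?Z \<inter> {u<..})"
    by (auto simp: contact_set_shift[OF x] image_iff intro!: bexI[of _ "_ + u"])
  show "contact_G \<alpha> (shift_path u x) = prev_point ?Z u - u"
    unfolding contact_G_def G prev_point_def
    by (subst Sup_add_eq) (use Z in \<open>auto simp: two_sided_closed_def\<close>)
  show "contact_D \<alpha> (shift_path u x) = next_point ?Z u - u"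
    unfolding contact_D_def D next_point_def
    by (subst Inf_add_eq) (use Z in \<open>auto simp: two_sided_closed_def\<close>)
qed

lemma contact_GD_eq_points: "contact_G \<alpha> x = prev_point (contact_set \<alpha> x) 0" "contact_D \<alpha> x = next_point (contact_set \<alpha> x) 0"
  by (simp_all add: contact_G_def contact_D_def prev_point_def next_point_def)

text \<open>Moving the origin within its gap moves \<open>G\<close> and \<open>D\<close> along and subtracts a constant from the path,
which cancels in the increments that make up \<open>V\<close>.\<close>
lemma process_V_shift:
  assumes x: "cadlag x" and Z: "two_sided_closed (contact_set \<alpha> x)"
    and gap: "0 \<notin> contact_set \<alpha> x" "u \<notin> contact_set \<alpha> x" "contact_G \<alpha> x < u" "u < contact_D \<alpha> x"
  shows "contact_D \<alpha> (shift_path u x) = contact_D \<alpha> x - u"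
    and "contact_G \<alpha> (shift_path u x) = contact_G \<alpha> x - u"
    and "zeta_V \<alpha> (shift_path u x) = zeta_V \<alpha> x"
    and "process_V \<alpha> (shift_path u x) = process_V \<alpha> x"
proof -
  note g = same_gap[OF Z gap[unfolded contact_GD_eq_points]]
  show D: "contact_D \<alpha> (shift_path u x) = contact_D \<alpha> x - u"
    and G: "contact_G \<alpha> (shift_path u x) = contact_G \<alpha> x - u"
    using g contact_GD_shift[OF x Z, of u] by (simp_all add: contact_GD_eq_points)
  show z: "zeta_V \<alpha> (shift_path u x) = zeta_V \<alpha> x" by (simp add: zeta_V_def D G)
  show "process_V \<alpha> (shift_path u x) = process_V \<alpha> x"
    by (rule ext) (simp add: process_V_def z D left_lim_shift[OF x] shift_path_def algebra_simps)
qed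

text \<open>The relation ``\<open>u\<close> lies in the gap of the origin'' is symmetric. This turns the mass sent by the
origin into the mass received by it.\<close>
lemma gap_sym:
  assumes x: "cadlag x" and Z: "two_sided_closed (contact_set \<alpha> x)"
    and nz: "0 \<notin> contact_set \<alpha> x" "u \<notin> contact_set \<alpha> x"
  shows "contact_G \<alpha> (shift_path u x) < - u \<and> - u < contact_D \<alpha> (shift_path u x)
    \<longleftrightarrow> contact_G \<alpha> x < u \<and> u < contact_D \<alpha> x"
proof -
  let ?Z = "contact_set \<alpha> x"
  have "prev_point ?Z u < 0 \<and> 0 < next_point ?Z u \<longleftrightarrow> prev_point ?Z 0 < u \<and> u < next_point ?Z 0"
  proof
    assume "prev_point ?Z u < 0 \<and> 0 < next_point ?Z u"
    then show "prev_point ?Z 0 < u \<and> u < next_point ?Z 0"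
      using same_gap[OF Z nz(2,1)] prev_point(2)[OF Z nz(2)] next_point(2)[OF Z nz(2)] by simp
  next
    assume "prev_point ?Z 0 < u \<and> u < next_point ?Z 0"
    then show "prev_point ?Z u < 0 \<and> 0 < next_point ?Z u"
      using same_gap[OF Z nz] prev_point(2)[OF Z nz(1)] next_point(2)[OF Z nz(1)] by simp
  qed
  then show ?thesis
    unfolding contact_GD_shift[OF x Z] by (simp add: contact_GD_eq_points)
qed

section \<open>Contacts seen from rational times\<close>

lemma lower_value_approx:
  assumes x: "cadlag x"
  obtains q where "\<And>k. q k \<in> \<rat>" "q \<longlonglongrightarrow> t" "(\<lambda>k. x (q k)) \<longlonglongrightarrow> lower_value x t"
proof (cases "x t \<le> left_lim x t")
  case True
  show thesis
    by (rule that[of "\<lambda>k. dyadic_above k t"])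
       (use cadlag_dyadic_above[OF x, of t] dyadic_above_tendsto[of t] True in
         \<open>auto simp: dyadic_rat lower_value_def min_def filterlim_at\<close>)
next
  case False
  show thesis
    by (rule that[of "\<lambda>k. dyadic_below k t"])
       (use cadlag_dyadic_below[OF x, of t] dyadic_below_tendsto[of t] False in
         \<open>auto simp: dyadic_rat lower_value_def min_def filterlim_at\<close>)
qed

text \<open>Whether a compact interval contains a contact point is decided by the values at rational times: a
contact point is approximated by rational times at which the contact inequalities almost hold, and
conversely a limit of such times is a contact point by lower semicontinuity. The interval is enlarged a
little because the approximating times may lie outside of it.\<close>
lemma contact_hits_Icc:
  assumes x: "cadlag x" and \<alpha>: "\<alpha> > 0"
  shows "contact_set \<alpha> x \<inter> {a..b} \<noteq> {} \<longleftrightarrow>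
    (\<forall>n. \<exists>q\<in>\<rat>. a - 1 / real (Suc n) < q \<and> q < b + 1 / real (Suc n) \<and>
           (\<forall>s\<in>\<rat>. x q \<le> x s + \<alpha> * \<bar>q - s\<bar> + 1 / real (Suc n)))"
    (is "?L \<longleftrightarrow> (\<forall>n. \<exists>q\<in>\<rat>. ?R n q)")
proof
  assume ?L
  then obtain t where t: "t \<in> contact_set \<alpha> x" "a \<le> t" "t \<le> b" by auto
  obtain q where q: "\<And>k. q k \<in> \<rat>" "q \<longlonglongrightarrow> t" "(\<lambda>k. x (q k)) \<longlonglongrightarrow> lower_value x t"
    using lower_value_approx[OF x] by blast
  show "\<forall>n. \<exists>q\<in>\<rat>. ?R n q"
  proof
    fix n
    define e where "e = 1 / real (Suc n)"
    have "e > 0" by (simp add: e_def)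
    have "(\<lambda>k. \<alpha> * \<bar>q k - t\<bar>) \<longlonglongrightarrow> \<alpha> * \<bar>t - t\<bar>" by (intro tendsto_intros q)
    then have "\<forall>\<^sub>F k in sequentially. \<alpha> * \<bar>q k - t\<bar> < e / 2"
      using \<open>e > 0\<close> by (intro order_tendstoD) auto
    moreover have "\<forall>\<^sub>F k in sequentially. x (q k) < lower_value x t + e / 2"
      using \<open>e > 0\<close> by (intro order_tendstoD(2)[OF q(3)]) auto
    moreover have "\<forall>\<^sub>F k in sequentially. t - e < q k" "\<forall>\<^sub>F k in sequentially. q k < t + e"
      using \<open>e > 0\<close> by (intro order_tendstoD[OF q(2)]; simp)+
    ultimately have "\<forall>\<^sub>F k in sequentially. \<alpha> * \<bar>q k - t\<bar> < e / 2 \<and>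
       x (q k) < lower_value x t + e / 2 \<and> t - e < q k \<and> q k < t + e"
      by eventually_elim simp
    then obtain k where k: "\<alpha> * \<bar>q k - t\<bar> < e / 2" "x (q k) < lower_value x t + e / 2" 
       "t - e < q k" "q k < t + e"
      using eventually_happens'[OF sequentially_bot] by blast
    have "x (q k) \<le> x s + \<alpha> * \<bar>q k - s\<bar> + e" for s
    proof -
      have "lower_value x t \<le> x s + \<alpha> * \<bar>t - s\<bar>" using t by (simp add: contact_set_iff[OF x])
      moreover have "\<alpha> * \<bar>t - s\<bar> \<le> \<alpha> * (\<bar>q k - t\<bar> + \<bar>q k - s\<bar>)" using \<alpha> by (intro mult_left_mono) auto
      ultimately show ?thesis using k by (simp add: algebra_simps)
    qed
    then have "?R n (q k)" using k t unfolding e_def[symmetric] by auto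
    with q(1) show "\<exists>q\<in>\<rat>. ?R n q" by blast
  qed
next
  assume "\<forall>n. \<exists>q\<in>\<rat>. ?R n q"
  then obtain q where q: "\<And>n. ?R n (q n)" by metis
  have "\<forall>n. q n \<in> {a - 1..b + 1}"
  proof
    fix n
    have "1 / real (Suc n) \<le> 1" by simp
    then show "q n \<in> {a - 1..b + 1}" using q[of n] unfolding atLeastAtMost_iff by linarith
  qed
  then obtain t \<sigma> where \<sigma>: "strict_mono \<sigma>" "(q \<circ> \<sigma>) \<longlonglongrightarrow> t"
    using compact_Icc[unfolded compact_def] by meson
  have "(\<lambda>k. 1 / real (Suc k)) \<longlonglongrightarrow> 0" by (rule LIMSEQ_Suc[OF lim_inverse_n'])
  from LIMSEQ_subseq_LIMSEQ[OF this \<sigma>(1)]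
  have lim0: "(\<lambda>k. 1 / real (Suc (\<sigma> k))) \<longlonglongrightarrow> 0" by (simp add: o_def)
  have "a - 0 \<le> t"
    by (rule tendsto_le[OF _ \<sigma>(2) tendsto_diff[OF tendsto_const lim0]])
       (use q in \<open>auto intro!: always_eventually less_imp_le simp del: of_nat_Suc\<close>)
  moreover have "t \<le> b + 0"
    by (rule tendsto_le[OF _ tendsto_add[OF tendsto_const lim0] \<sigma>(2)])
       (use q in \<open>auto intro!: always_eventually less_imp_le simp del: of_nat_Suc\<close>)
  moreover have "lower_value x t \<le> x s + \<alpha> * \<bar>t - s\<bar>" if "s \<in> \<rat>" for s
  proof (rule field_le_epsilon)
    fix e :: real assume "e > 0"
    have "lower_value x t - e \<le> x s + \<alpha> * \<bar>t - s\<bar> + 0"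
    proof (rule tendsto_lowerbound)
      show "(\<lambda>k. x s + \<alpha> * \<bar>(q \<circ> \<sigma>) k - s\<bar> + 1 / real (Suc (\<sigma> k))) \<longlonglongrightarrow> x s + \<alpha> * \<bar>t - s\<bar> + 0"
        by (intro tendsto_intros \<sigma> lim0)
      have "\<forall>\<^sub>F k in sequentially. lower_value x t - e < x ((q \<circ> \<sigma>) k)"
        using lower_value_less_nearby[OF x \<open>e > 0\<close>] \<sigma>(2) by (rule eventually_compose_filterlim)
      then show "\<forall>\<^sub>F k in sequentially. lower_value x t - e \<le> x s + \<alpha> * \<bar>(q \<circ> \<sigma>) k - s\<bar> + 1 / real (Suc (\<sigma> k))"
      proof eventually_elim
        case (elim k)
        have "x (q (\<sigma> k)) \<le> x s + \<alpha> * \<bar>q (\<sigma> k) - s\<bar> + 1 / real (Suc (\<sigma> k))"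
          using q[of "\<sigma> k"] that by blast
        with elim show ?case by (simp del: of_nat_Suc)
      qed
    qed simp
    then show "lower_value x t \<le> x s + \<alpha> * \<bar>t - s\<bar> + e" by simp
  qed
  then have "t \<in> contact_set \<alpha> x" by (simp add: contact_set_iff_rat[OF x])
  ultimately show ?L by auto
qed

section \<open>Measurability of path functionals\<close>

text \<open>The set of cadlag paths is not measurable in the uncountable product, so the trace sigma-algebra on
it is used.\<close>
definition path_space :: "(real \<Rightarrow> real) measure" where
  "path_space = restrict_space (Pi\<^sub>M UNIV (\<lambda>_. borel)) {x. cadlag x}"

lemma space_path_space: "space path_space = {x. cadlag x}"
  by (simp add: path_space_def space_restrict_space space_PiM)

lemma path_space_cadlag: "p \<in> measurable N path_space \<Longrightarrow> \<omega> \<in> space N \<Longrightarrow> cadlag (p \<omega>)"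
  using measurable_space[of p N path_space \<omega>] by (simp add: space_path_space)

lemma measurable_path_spaceI:
  assumes "\<And>\<omega>. \<omega> \<in> space N \<Longrightarrow> cadlag (p \<omega>)" "\<And>t. (\<lambda>\<omega>. p \<omega> t) \<in> borel_measurable N"
  shows "p \<in> measurable N path_space"
  unfolding path_space_def
proof (rule measurable_restrict_space2)
  show "p \<in> measurable N (Pi\<^sub>M UNIV (\<lambda>_. borel))"
    using assms(2) by (intro measurable_PiM_single') (auto simp: space_PiM)
qed (use assms(1) in auto)

lemma measurable_eval_const:
  assumes "p \<in> measurable N path_space"
  shows "(\<lambda>\<omega>. p \<omega> t) \<in> borel_measurable N"
proof -
  have "(\<lambda>x. x t) \<in> borel_measurable path_space"
    unfolding path_space_def by (intro measurable_restrict_space1 measurable_component_singleton) simp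
  then show ?thesis using assms by (rule measurable_compose[rotated])
qed

lemma measurable_coordinate [measurable]: "(\<lambda>x. x t) \<in> borel_measurable path_space"
  by (rule measurable_eval_const) simp

text \<open>Joint measurability in time and path: the dyadic approximation of the time takes countably many
values, so only evaluations at fixed times enter before the limit.\<close>
lemma measurable_eval:
  assumes p: "p \<in> measurable N path_space" and h: "h \<in> borel_measurable N"
  shows "(\<lambda>\<omega>. p \<omega> (h \<omega>)) \<in> borel_measurable N"
proof (rule borel_measurable_LIMSEQ_real)
  show "(\<lambda>k. p \<omega> (dyadic_above k (h \<omega>))) \<longlonglongrightarrow> p \<omega> (h \<omega>)" if "\<omega> \<in> space N" for \<omega>
    by (intro cadlag_dyadic_above path_space_cadlag[OF p that])
  show "(\<lambda>\<omega>. p \<omega> (dyadic_above k (h \<omega>))) \<in> borel_measurable N" for k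
    unfolding dyadic_above_def
    by (rule measurable_compose_countable[where f = "\<lambda>i \<omega>. p \<omega> ((of_int i + 1) / 2 ^ k)"])
       (use h in \<open>auto intro!: measurable_eval_const p\<close>)
qed

lemma borel_measurable_pred_le:
  fixes f g :: "'a \<Rightarrow> real"
  assumes "f \<in> borel_measurable N" "g \<in> borel_measurable N"
  shows "Measurable.pred N (\<lambda>\<omega>. f \<omega> \<le> g \<omega>)"
  using assms by measurable

lemma measurable_left_lim:
  assumes p: "p \<in> measurable N path_space" and h: "h \<in> borel_measurable N"
  shows "(\<lambda>\<omega>. left_lim (p \<omega>) (h \<omega>)) \<in> borel_measurable N"
proof (rule borel_measurable_LIMSEQ_real)
  show "(\<lambda>k. p \<omega> (dyadic_below k (h \<omega>))) \<longlonglongrightarrow> left_lim (p \<omega>) (h \<omega>)" if "\<omega> \<in> space N" for \<omega>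
    by (intro cadlag_dyadic_below path_space_cadlag[OF p that])
  show "(\<lambda>\<omega>. p \<omega> (dyadic_below k (h \<omega>))) \<in> borel_measurable N" for k
    unfolding dyadic_below_def
    by (rule measurable_compose_countable[where f = "\<lambda>i \<omega>. p \<omega> ((of_int i - 1) / 2 ^ k)"])
       (use h in \<open>auto intro!: measurable_eval_const p\<close>)
qed

lemma measurable_lower_value:
  assumes "p \<in> measurable N path_space" "h \<in> borel_measurable N"
  shows "(\<lambda>\<omega>. lower_value (p \<omega>) (h \<omega>)) \<in> borel_measurable N"
  unfolding lower_value_def using assms
  by (intro borel_measurable_min) (rule measurable_eval measurable_left_lim; assumption)+

lemma measurable_shift:
  assumes p: "p \<in> measurable N path_space" and h: "h \<in> borel_measurable N"
  shows "(\<lambda>\<omega>. shift_path (h \<omega>) (p \<omega>)) \<in> measurable N path_space"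
proof (rule measurable_path_spaceI)
  show "cadlag (shift_path (h \<omega>) (p \<omega>))" if "\<omega> \<in> space N" for \<omega>
    by (intro cadlag_shift path_space_cadlag[OF p that])
  show "(\<lambda>\<omega>. shift_path (h \<omega>) (p \<omega>) t) \<in> borel_measurable N" for t
    unfolding shift_path_def using assms
    by (intro borel_measurable_diff borel_measurable_add borel_measurable_const
         measurable_eval[OF p] measurable_eval_const[OF p])
qed

lemma pred_ball_rat:
  assumes "\<And>q. Measurable.pred N (\<lambda>\<omega>. R \<omega> q)"
  shows "Measurable.pred N (\<lambda>\<omega>. \<forall>q\<in>\<rat>. R \<omega> (q::real))"
proof -
  have "Measurable.pred N (\<lambda>\<omega>. \<forall>r::rat. R \<omega> (of_rat r))"
    by (intro pred_intros_countable(1) assms)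
  then show ?thesis by (simp add: Rats_def)
qed

lemma pred_bex_rat:
  assumes "\<And>q. Measurable.pred N (\<lambda>\<omega>. R \<omega> q)"
  shows "Measurable.pred N (\<lambda>\<omega>. \<exists>q\<in>\<rat>. R \<omega> (q::real))"
proof -
  have "Measurable.pred N (\<lambda>\<omega>. \<exists>r::rat. R \<omega> (of_rat r))"
    by (intro pred_intros_countable(2) assms)
  then show ?thesis by (simp add: Rats_def)
qed

lemma pred_contact_set:
  assumes p: "p \<in> measurable N path_space" and h: "h \<in> borel_measurable N"
  shows "Measurable.pred N (\<lambda>\<omega>. h \<omega> \<in> contact_set \<alpha> (p \<omega>))"
proof -
  have "Measurable.pred N (\<lambda>\<omega>. \<forall>s\<in>\<rat>. lower_value (p \<omega>) (h \<omega>) \<le> p \<omega> s + \<alpha> * \<bar>h \<omega> - s\<bar>)"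
    by (rule pred_ball_rat) (intro borel_measurable_pred_le borel_measurable_add borel_measurable_times borel_measurable_abs
        borel_measurable_diff borel_measurable_const measurable_lower_value measurable_eval_const p h)
  then show ?thesis
    by (rule measurable_cong[THEN iffD1, rotated]) (simp add: contact_set_iff_rat path_space_cadlag[OF p])
qed

lemma pred_contact_hits_Icc:
  assumes \<alpha>: "\<alpha> > 0"
  shows "Measurable.pred path_space (\<lambda>x. contact_set \<alpha> x \<inter> {a..b} \<noteq> {})"
proof -
  have "Measurable.pred path_space (\<lambda>x. \<forall>n. \<exists>q\<in>\<rat>. a - 1 / real (Suc n) < q \<and> q < b + 1 / real (Suc n) \<and>
           (\<forall>s\<in>\<rat>. x q \<le> x s + \<alpha> * \<bar>q - s\<bar> + 1 / real (Suc n)))"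
    by (intro pred_intros_countable(1) pred_bex_rat pred_intros_logic(3) pred_ball_rat
          borel_measurable_pred_le borel_measurable_add measurable_coordinate borel_measurable_const)
       simp_all
  then show ?thesis
    by (rule measurable_cong[THEN iffD1, rotated]) (simp add: contact_hits_Icc[OF _ \<alpha>] space_path_space)
qed

lemma pred_contact_hits_open:
  assumes \<alpha>: "\<alpha> > 0"
  shows "Measurable.pred path_space (\<lambda>x. contact_set \<alpha> x \<inter> {a<..<b} \<noteq> {})"
proof -
  have "contact_set \<alpha> x \<inter> {a<..<b} \<noteq> {} \<longleftrightarrow>
    (\<exists>c\<in>\<rat>. \<exists>d\<in>\<rat>. a < c \<and> d < b \<and> contact_set \<alpha> x \<inter> {c..d} \<noteq> {})" (is "?L \<longleftrightarrow> ?R") for x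
  proof
    assume ?L
    then obtain t where t: "t \<in> contact_set \<alpha> x" "a < t" "t < b" by auto
    obtain c d where "c \<in> \<rat>" "a < c" "c < t" "d \<in> \<rat>" "t < d" "d < b"
      using Rats_dense_in_real[OF t(2)] Rats_dense_in_real[OF t(3)] by blast
    with t(1) show ?R by (intro bexI[of _ c] bexI[of _ d]) auto
  next
    assume ?R
    then obtain c d t where "a < c" "d < b" "t \<in> contact_set \<alpha> x" "c \<le> t" "t \<le> d" by auto
    then have "t \<in> contact_set \<alpha> x \<inter> {a<..<b}" by auto
    then show ?L by blast
  qed
  moreover have "Measurable.pred path_space
      (\<lambda>x. \<exists>c\<in>\<rat>. \<exists>d\<in>\<rat>. a < c \<and> d < b \<and> contact_set \<alpha> x \<inter> {c..d} \<noteq> {})"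
    by (intro pred_bex_rat pred_intros_logic(3) pred_contact_hits_Icc \<alpha>) measurable
  ultimately show ?thesis by simp
qed

text \<open>If there is no contact point to the right of the origin, \<open>D\<close> is the unspecified constant \<open>Inf {}\<close>.
Treating this case separately keeps \<open>D\<close> measurable on all of the path space and not only almost
surely, so the probability space does not have to be complete.\<close>
lemma measurable_contact_D:
  assumes \<alpha>: "\<alpha> > 0"
  shows "contact_D \<alpha> \<in> borel_measurable path_space"
  unfolding borel_measurable_iff_less
proof
  fix r
  have eq: "contact_D \<alpha> x < r \<longleftrightarrow> contact_set \<alpha> x \<inter> {0<..<r} \<noteq> {} \<or>
      \<not> (\<exists>n. contact_set \<alpha> x \<inter> {0<..<real n} \<noteq> {}) \<and> Inf {} < r" for x
  proof (cases "contact_set \<alpha> x \<inter> {0<..} = {}")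
    case True
    then have "contact_set \<alpha> x \<inter> {0<..<b} = {}" for b by auto
    then show ?thesis using True by (simp add: contact_D_def)
  next
    case False
    then obtain t where t: "t \<in> contact_set \<alpha> x" "0 < t" by auto
    obtain n where "t < real n" using reals_Archimedean2 by blast
    then have "contact_set \<alpha> x \<inter> {0<..<real n} \<noteq> {}" using t by auto
    moreover have "contact_D \<alpha> x < r \<longleftrightarrow> (\<exists>z\<in>contact_set \<alpha> x \<inter> {0<..}. z < r)"
      unfolding contact_D_def using False by (intro cInf_less_iff bdd_belowI[of _ 0]) auto
    ultimately show ?thesis by auto
  qed
  have "Measurable.pred path_space (\<lambda>x. contact_D \<alpha> x < r)"
    unfolding eq
    by (intro pred_intros_logic pred_intros_countable pred_contact_hits_open \<alpha>) measurable
  then show "{x \<in> space path_space. contact_D \<alpha> x < r} \<in> sets path_space"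
    by (simp add: pred_def)
qed

lemma measurable_contact_G:
  assumes \<alpha>: "\<alpha> > 0"
  shows "contact_G \<alpha> \<in> borel_measurable path_space"
  unfolding borel_measurable_iff_greater
proof
  fix r
  have eq: "r < contact_G \<alpha> x \<longleftrightarrow> contact_set \<alpha> x \<inter> {r<..<0} \<noteq> {} \<or>
      \<not> (\<exists>n. contact_set \<alpha> x \<inter> {- real n<..<0} \<noteq> {}) \<and> r < Sup {}" for x
  proof (cases "contact_set \<alpha> x \<inter> {..<0} = {}")
    case True
    then have "contact_set \<alpha> x \<inter> {b<..<0} = {}" for b by auto
    then show ?thesis using True by (simp add: contact_G_def)
  next
    case False
    then obtain t where t: "t \<in> contact_set \<alpha> x" "t < 0" by auto
    obtain n where "- t < real n" using reals_Archimedean2 by blast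
    then have "contact_set \<alpha> x \<inter> {- real n<..<0} \<noteq> {}" using t by auto
    moreover have "r < contact_G \<alpha> x \<longleftrightarrow> (\<exists>z\<in>contact_set \<alpha> x \<inter> {..<0}. r < z)"
      unfolding contact_G_def using False by (intro less_cSup_iff bdd_aboveI[of _ 0]) auto
    ultimately show ?thesis by auto
  qed
  have "Measurable.pred path_space (\<lambda>x. r < contact_G \<alpha> x)"
    unfolding eq
    by (intro pred_intros_logic pred_intros_countable pred_contact_hits_open \<alpha>) measurable
  then show "{x \<in> space path_space. r < contact_G \<alpha> x} \<in> sets path_space"
    by (simp add: pred_def)
qed

lemma measurable_process_V:
  assumes \<alpha>: "\<alpha> > 0" and F: "F \<in> borel_measurable borel_cemetery"
  shows "(\<lambda>x. F (process_V \<alpha> x t)) \<in> borel_measurable path_space"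
proof -
  have "Some \<in> measurable borel borel_cemetery"
    unfolding borel_cemetery_def by (rule measurable_measure_of) auto
  then have [measurable]: "(\<lambda>y. F (Some y)) \<in> borel_measurable borel"
    using F by (rule measurable_compose)
  note [measurable] = measurable_contact_D[OF \<alpha>] measurable_contact_G[OF \<alpha>]
  have [measurable]: "(\<lambda>x. x (contact_D \<alpha> x)) \<in> borel_measurable path_space"
    by (rule measurable_eval) measurable
  have [measurable]: "(\<lambda>x. left_lim x (contact_D \<alpha> x - t)) \<in> borel_measurable path_space"
    by (rule measurable_left_lim) measurable
  have "(\<lambda>x. F (process_V \<alpha> x t)) = (\<lambda>x. if t < contact_D \<alpha> x - contact_G \<alpha> x
      then F (Some (x (contact_D \<alpha> x) - left_lim x (contact_D \<alpha> x - t))) else F None)"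
    by (auto simp: process_V_def zeta_V_def fun_eq_iff)
  also have "\<dots> \<in> borel_measurable path_space" by measurable
  finally show ?thesis .
qed

section \<open>Random walks with positive mean\<close>

text \<open>The minimum of the partial sums of length at most \<open>n\<close>. The recursion splits off the first step, in
the way in which an i.i.d. sequence is decomposed into its first entry and the rest.\<close>
primrec run_min :: "nat \<Rightarrow> (nat \<Rightarrow> real) \<Rightarrow> real" where
  "run_min 0 s = 0"
| "run_min (Suc n) s = min 0 (s 0 + run_min n (\<lambda>i. s (Suc i)))"

lemma run_min_le: "k \<le> n \<Longrightarrow> run_min n s \<le> (\<Sum>i<k. s i)"
proof (induction n arbitrary: s k)
  case (Suc n)
  show ?case
  proof (cases k)
    case (Suc j)
    with Suc.prems Suc.IH[of j "\<lambda>i. s (Suc i)"] show ?thesis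
      by (simp only: sum.lessThan_Suc_shift) (simp add: min.coboundedI2)
  qed simp
qed simp

lemma run_min_attained: "\<exists>k\<le>n. run_min n s = (\<Sum>i<k. s i)"
proof (induction n arbitrary: s)
  case (Suc n)
  obtain k where k: "k \<le> n" "run_min n (\<lambda>i. s (Suc i)) = (\<Sum>i<k. s (Suc i))"
    using Suc.IH by blast
  show ?case
  proof (cases "0 \<le> s 0 + run_min n (\<lambda>i. s (Suc i))")
    case True
    then show ?thesis by (intro exI[of _ 0]) simp
  next
    case False
    with k show ?thesis
      by (intro exI[of _ "Suc k"]) (simp only: sum.lessThan_Suc_shift run_min.simps, simp)
  qed
qed simp

lemma run_min_nonpos: "run_min n s \<le> 0"
  using run_min_le[of 0 n s] by simp

lemma run_min_mono: "m \<le> n \<Longrightarrow> run_min n s \<le> run_min m s"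
  by (metis run_min_attained run_min_le order_trans)

lemma run_min_abs: "\<bar>run_min n s\<bar> \<le> (\<Sum>i<n. \<bar>s i\<bar>)"
proof -
  obtain k where "k \<le> n" "run_min n s = (\<Sum>i<k. s i)" using run_min_attained by blast
  then have "\<bar>run_min n s\<bar> \<le> (\<Sum>i<k. \<bar>s i\<bar>)" by simp
  also have "\<dots> \<le> (\<Sum>i<n. \<bar>s i\<bar>)" using \<open>k \<le> n\<close> by (intro sum_mono2) auto
  finally show ?thesis .
qed

definition run_unbounded :: "(nat \<Rightarrow> real) \<Rightarrow> bool" where
  "run_unbounded s \<longleftrightarrow> (\<forall>K::nat. \<exists>n. run_min n s < - real K)"

text \<open>A first step changes all running minima by at most its absolute value.\<close>
lemma run_unbounded_case_nat: "run_unbounded (case_nat x w) \<longleftrightarrow> run_unbounded w"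
proof
  assume *: "run_unbounded (case_nat x w)"
  show "run_unbounded w"
    unfolding run_unbounded_def
  proof
    fix K :: nat
    obtain L :: nat where L: "real K + \<bar>x\<bar> \<le> real L" using real_arch_simple by blast
    obtain n where n: "run_min n (case_nat x w) < - real L" using * by (auto simp: run_unbounded_def)
    then obtain m where "n = Suc m" by (cases n) auto
    with n L have "run_min m w < - real K" by (auto simp: min_def split: if_splits)
    then show "\<exists>n. run_min n w < - real K" by blast
  qed
next
  assume *: "run_unbounded w"
  show "run_unbounded (case_nat x w)"
    unfolding run_unbounded_def
  proof
    fix K :: nat
    obtain L :: nat where L: "real K + \<bar>x\<bar> \<le> real L" using real_arch_simple by blast
    obtain n where "run_min n w < - real L" using * by (auto simp: run_unbounded_def)
    then have "run_min (Suc n) (case_nat x w) < - real K" using L by auto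
    then show "\<exists>n. run_min n (case_nat x w) < - real K" by blast
  qed
qed

lemma bdd_below_if_not_run_unbounded:
  assumes "\<not> run_unbounded s"
  shows "\<exists>K. \<forall>n. K \<le> (\<Sum>i<n. s i)"
proof -
  obtain K :: nat where "\<And>n. - real K \<le> run_min n s"
    using assms by (auto simp: run_unbounded_def not_less)
  then show ?thesis using run_min_le order_trans by blast
qed

lemma distr_pair_snd:
  assumes "prob_space M" "sigma_finite_measure N"
  shows "distr (M \<Otimes>\<^sub>M N) N snd = N"
proof (rule measure_eqI)
  interpret M: prob_space M by fact
  interpret N: sigma_finite_measure N by fact
  fix A assume "A \<in> sets (distr (M \<Otimes>\<^sub>M N) N snd)"
  then have A: "A \<in> sets N" by simp
  then have "snd -` A \<inter> space (M \<Otimes>\<^sub>M N) = space M \<times> A"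
    using sets.sets_into_space[OF A] by (auto simp: space_pair_measure)
  with A show "emeasure (distr (M \<Otimes>\<^sub>M N) N snd) A = emeasure N A"
    by (simp add: emeasure_distr N.emeasure_pair_measure_Times M.emeasure_space_1)
qed simp

lemma measurable_run_min:
  assumes "sets \<mu> = sets borel"
  shows "run_min n \<in> borel_measurable (Pi\<^sub>M UNIV (\<lambda>_::nat. \<mu>))"
proof (induction n)
  case 0
  then show ?case by (simp add: fun_eq_iff[symmetric] cong: measurable_cong)
next
  case (Suc n)
  have comp: "(\<lambda>s. s i) \<in> borel_measurable (Pi\<^sub>M UNIV (\<lambda>_::nat. \<mu>))" for i
    using measurable_component_singleton[of i UNIV "\<lambda>_. \<mu>"] assms
    by (simp cong: measurable_cong_sets)
  have "(\<lambda>s i. s (Suc i)) \<in> measurable (Pi\<^sub>M UNIV (\<lambda>_. \<mu>)) (Pi\<^sub>M UNIV (\<lambda>_::nat. \<mu>))"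
    by (intro measurable_PiM_single' measurable_component_singleton) (auto simp: space_PiM)
  from measurable_compose[OF this Suc.IH]
  have "(\<lambda>s. min 0 (s 0 + run_min n (\<lambda>i. s (Suc i)))) \<in> borel_measurable (Pi\<^sub>M UNIV (\<lambda>_::nat. \<mu>))"
    by (intro borel_measurable_min borel_measurable_add comp borel_measurable_const)
  then show ?case by (simp cong: measurable_cong)
qed

text \<open>Garsia's argument. Let \<open>m\<^sub>n\<close> be the running minimum, \<open>m'\<^sub>n\<close> the running minimum of the sequence
without its first step \<open>x\<close>, and \<open>A\<close> the event that the minima tend to \<open>-\<infinity>\<close>, which does not depend on
\<open>x\<close>. Then \<open>m\<^bsub>n+1\<^esub> - m'\<^sub>n = min (-m'\<^sub>n) x\<close>. Its mean over \<open>A\<close> is at most \<open>0\<close>, because \<open>m'\<^sub>n\<close> has the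
same law as \<open>m\<^sub>n \<ge> m\<^bsub>n+1\<^esub>\<close>. On \<open>A\<close> it tends to \<open>x\<close>, so by independence the product of the mean of \<open>x\<close>
and the probability of \<open>A\<close> is at most \<open>0\<close>.\<close>
lemma AE_not_run_unbounded:
  fixes \<mu> :: "real measure"
  assumes \<mu>: "prob_space \<mu>" "sets \<mu> = sets borel"
    and int: "integrable \<mu> (\<lambda>x. x)" and pos: "(\<integral>x. x \<partial>\<mu>) > 0"
  shows "AE s in (Pi\<^sub>M UNIV (\<lambda>_::nat. \<mu>)). \<not> run_unbounded s"
proof -
  interpret \<mu>: prob_space \<mu> by fact
  interpret SS: sequence_space \<mu> by unfold_locales
  define Q where "Q = Pi\<^sub>M UNIV (\<lambda>_::nat. \<mu>)"
  interpret Q: prob_space Q unfolding Q_def by (rule prob_space_PiM) (rule \<mu>.prob_space_axioms)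
  interpret pair_prob_space \<mu> Q by unfold_locales
  have [measurable_cong]: "sets \<mu> = sets borel" by fact
  have [measurable]: "run_min n \<in> borel_measurable Q" for n
    unfolding Q_def by (rule measurable_run_min) fact
  define A where "A = {s \<in> space Q. run_unbounded s}"
  have [measurable]: "A \<in> sets Q" unfolding A_def run_unbounded_def by measurable
  have spQ: "space Q = UNIV" using sets_eq_imp_space_eq[OF \<mu>(2)] by (simp add: Q_def space_PiM)
  have A_iff: "s \<in> A \<longleftrightarrow> run_unbounded s" for s by (simp add: A_def spQ)
  have comp: "integrable Q (\<lambda>s. s i)" for i
  proof -
    have "distr Q \<mu> (\<lambda>s. s i) = \<mu>"
      unfolding Q_def by (rule distr_PiM_component) (simp_all add: \<mu>.prob_space_axioms)
    moreover have "(\<lambda>s. s i) \<in> measurable Q \<mu>"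
      unfolding Q_def by (rule measurable_component_singleton) simp
    ultimately show ?thesis using integrable_distr[of "\<lambda>s. s i" Q \<mu> "\<lambda>x. x"] int by metis
  qed
  have int_m: "integrable Q (\<lambda>s. run_min n s * indicator A s)" for n
  proof (rule Bochner_Integration.integrable_bound)
    show "integrable Q (\<lambda>s. \<Sum>i<n. \<bar>s i\<bar>)" by (intro Bochner_Integration.integrable_sum integrable_abs comp)
    show "AE s in Q. norm (run_min n s * indicator A s) \<le> norm (\<Sum>i<n. \<bar>s i\<bar>)"
      using run_min_abs by (auto simp: indicator_def intro!: AE_I2 intro: order_trans sum_nonneg)
  qed measurable
  define a where "a n = (\<integral>s. run_min n s * indicator A s \<partial>Q)" for n
  have snd: "distr (\<mu> \<Otimes>\<^sub>M Q) Q snd = Q" by (rule distr_pair_snd) unfold_locales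
  have iter: "distr (\<mu> \<Otimes>\<^sub>M Q) Q (\<lambda>p. case_nat (fst p) (snd p)) = Q"
    using SS.PiM_iter by (simp add: Q_def split_beta')
  have cn: "(\<lambda>p. case_nat (fst p) (snd p)) \<in> measurable (\<mu> \<Otimes>\<^sub>M Q) Q"
    unfolding Q_def by measurable
  have fst: "distr (\<mu> \<Otimes>\<^sub>M Q) \<mu> fst = \<mu>" by (rule Q.distr_pair_fst)
  have int_x: "integrable (\<mu> \<Otimes>\<^sub>M Q) (\<lambda>p. fst p)"
    using int integrable_distr[of fst "\<mu> \<Otimes>\<^sub>M Q" \<mu> "\<lambda>x. x"] by (simp add: fst)
  have int1: "integrable (\<mu> \<Otimes>\<^sub>M Q) (\<lambda>p. run_min n (snd p) * indicator A (snd p))" for n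
    using int_m[of n] integrable_distr[of snd "\<mu> \<Otimes>\<^sub>M Q" Q "\<lambda>s. run_min n s * indicator A s"]
    by (simp add: snd)
  have int2: "integrable (\<mu> \<Otimes>\<^sub>M Q) (\<lambda>p. run_min (Suc n) (case_nat (fst p) (snd p)) * indicator A (snd p))" for n
    using int_m[of "Suc n"] integrable_distr[OF cn, of "\<lambda>s. run_min (Suc n) s * indicator A s"]
    by (simp add: iter indicator_def A_iff run_unbounded_case_nat del: run_min.simps)
  have a1: "a n = (\<integral>p. run_min n (snd p) * indicator A (snd p) \<partial>(\<mu> \<Otimes>\<^sub>M Q))" for n
    unfolding a_def by (subst snd[symmetric], subst integral_distr) auto
  have a2: "a (Suc n) = (\<integral>p. run_min (Suc n) (case_nat (fst p) (snd p)) * indicator A (snd p) \<partial>(\<mu> \<Otimes>\<^sub>M Q))" for n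
    unfolding a_def
    by (subst iter[symmetric], subst integral_distr[OF cn borel_measurable_integrable[OF int_m]])
       (simp_all add: indicator_def A_iff run_unbounded_case_nat del: run_min.simps)
  define d where "d n p = min (- run_min n (snd p)) (fst p) * indicator A (snd p)" for n and p :: "real \<times> (nat \<Rightarrow> real)"
  have d_eq: "d n p = run_min (Suc n) (case_nat (fst p) (snd p)) * indicator A (snd p)
      - run_min n (snd p) * indicator A (snd p)" for n p
    by (auto simp: d_def indicator_def min_def)
  have "(\<integral>p. d n p \<partial>(\<mu> \<Otimes>\<^sub>M Q)) = a (Suc n) - a n" for n
    unfolding d_eq a1[of n] a2 by (intro Bochner_Integration.integral_diff int1 int2)
  moreover have "a (Suc n) \<le> a n" for n
    unfolding a_def using run_min_mono[of n "Suc n"]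
    by (intro integral_mono int_m mult_right_mono) (auto simp del: run_min.simps)
  \<comment> \<open>Garsia's inequality, before the passage to the limit.\<close>
  ultimately have d_nonpos: "(\<integral>p. d n p \<partial>(\<mu> \<Otimes>\<^sub>M Q)) \<le> 0" for n by simp
  have "(\<lambda>n. \<integral>p. d n p \<partial>(\<mu> \<Otimes>\<^sub>M Q)) \<longlonglongrightarrow> (\<integral>p. fst p * indicator A (snd p) \<partial>(\<mu> \<Otimes>\<^sub>M Q))"
  proof (rule integral_dominated_convergence[where w = "\<lambda>p. \<bar>fst p\<bar>"])
    show "d n \<in> borel_measurable (\<mu> \<Otimes>\<^sub>M Q)" for n unfolding d_def by measurable
    show "AE p in \<mu> \<Otimes>\<^sub>M Q. norm (d n p) \<le> \<bar>fst p\<bar>" for n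
      using run_min_nonpos[of n] by (intro AE_I2) (auto simp: d_def indicator_def min_def)
    show "AE p in \<mu> \<Otimes>\<^sub>M Q. (\<lambda>n. d n p) \<longlonglongrightarrow> fst p * indicator A (snd p)"
    proof (intro AE_I2)
      fix p :: "real \<times> (nat \<Rightarrow> real)"
      show "(\<lambda>n. d n p) \<longlonglongrightarrow> fst p * indicator A (snd p)"
      proof (cases "snd p \<in> A")
        case True
        obtain K :: nat where "\<bar>fst p\<bar> \<le> real K" using real_arch_simple by blast
        moreover obtain N where "run_min N (snd p) < - real K"
          using True by (auto simp: A_iff run_unbounded_def)
        ultimately have "d n p = fst p" if "N \<le> n" for n
          using run_min_mono[OF that, of "snd p"] True by (auto simp: d_def)
        then show ?thesis
          using True by (intro tendsto_eventually eventually_sequentiallyI[of N]) auto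
      qed (simp add: d_def)
    qed
  qed (use int_x in auto)
  then have "(\<integral>p. fst p * indicator A (snd p) \<partial>(\<mu> \<Otimes>\<^sub>M Q)) \<le> 0"
    by (rule LIMSEQ_le_const2) (use d_nonpos in auto)
  moreover have "(\<integral>p. fst p * indicator A (snd p) \<partial>(\<mu> \<Otimes>\<^sub>M Q)) = (\<integral>x. x \<partial>\<mu>) * measure Q A"
  proof -
    have "integrable (\<mu> \<Otimes>\<^sub>M Q) (\<lambda>p. fst p * indicator A (snd p))"
      by (rule Bochner_Integration.integrable_bound[OF int_x]) (auto simp: indicator_def)
    from integral_fst'[OF this] show ?thesis by (simp add: mult.commute)
  qed
  ultimately have "measure Q A = 0"
    using pos by (simp add: mult_le_0_iff zero_less_measure_iff[symmetric] measure_nonneg antisym)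
  then have "AE s in Q. s \<notin> A"
    by (subst AE_iff_measurable[OF \<open>A \<in> sets Q\<close>]) (auto simp: Q.emeasure_eq_measure A_def)
  then show ?thesis unfolding A_iff unfolding Q_def .
qed

lemma (in prob_space) iid_walk_bdd_below:
  fixes \<xi> :: "nat \<Rightarrow> 'a \<Rightarrow> real"
  assumes indep: "indep_vars (\<lambda>_. borel) \<xi> UNIV"
    and ident: "\<And>i. distr M borel (\<xi> i) = distr M borel (\<xi> 0)"
    and int: "integrable M (\<xi> 0)" and pos: "expectation (\<xi> 0) > 0"
  shows "AE \<omega> in M. \<exists>K. \<forall>n. K \<le> (\<Sum>i<n. \<xi> i \<omega>)"
proof -
  have rv: "random_variable borel (\<xi> i)" for i using indep by (simp add: indep_vars_def)
  define \<mu> where "\<mu> = distr M borel (\<xi> 0)"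
  have eq: "distr M (Pi\<^sub>M UNIV (\<lambda>_::nat. borel)) (\<lambda>\<omega> i. \<xi> i \<omega>) = Pi\<^sub>M UNIV (\<lambda>_. \<mu>)"
  proof -
    have "distr M (Pi\<^sub>M UNIV (\<lambda>_::nat. borel)) (\<lambda>\<omega>. \<lambda>i\<in>UNIV. \<xi> i \<omega>) = Pi\<^sub>M UNIV (\<lambda>i. distr M borel (\<xi> i))"
      using indep_vars_iff_distr_eq_PiM[where I = UNIV and X = \<xi> and M' = "\<lambda>_. borel"] rv indep
      by blast
    moreover have "(\<lambda>i. distr M borel (\<xi> i)) = (\<lambda>_. \<mu>)"
      unfolding \<mu>_def by (rule ext) (rule ident)
    ultimately show ?thesis by (simp add: restrict_UNIV)
  qed
  have meas: "(\<lambda>\<omega> i. \<xi> i \<omega>) \<in> measurable M (Pi\<^sub>M UNIV (\<lambda>_::nat. borel))"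
    by (intro measurable_PiM_single') (auto simp: rv space_PiM)
  have "AE s in Pi\<^sub>M UNIV (\<lambda>_::nat. \<mu>). \<not> run_unbounded s"
    by (rule AE_not_run_unbounded)
       (use int pos rv in \<open>auto simp: \<mu>_def integrable_distr_eq integral_distr intro!: prob_space_distr\<close>)
  then have "AE \<omega> in M. \<not> run_unbounded (\<lambda>i. \<xi> i \<omega>)"
    unfolding eq[symmetric] by (rule AE_distrD[OF meas])
  then show ?thesis
    by eventually_elim (rule bdd_below_if_not_run_unbounded)
qed

section \<open>Linear growth of Levy paths\<close>

lemma (in prob_space) indep_vars_nat_UNIV:
  assumes "\<And>n. indep_vars M' X {..<n::nat}"
  shows "indep_vars M' X UNIV"
  unfolding indep_vars_def2
proof (intro conjI ballI)
  fix i
  show "random_variable (M' i) (X i)"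
    using assms[of "Suc i"] by (auto simp: indep_vars_def2)
next
  show "indep_sets (\<lambda>i. {X i -` A \<inter> space M |A. A \<in> sets (M' i)}) UNIV"
    unfolding indep_sets_finite_index_sets[of _ UNIV]
  proof (intro allI impI)
    fix J :: "nat set" assume "J \<subseteq> UNIV" "J \<noteq> {}" "finite J"
    then obtain n where "J \<subseteq> {..<n}" by (metis finite_nat_iff_bounded)
    then show "indep_sets (\<lambda>i. {X i -` A \<inter> space M |A. A \<in> sets (M' i)}) J"
      using indep_vars_subset[OF assms[of n]] by (simp add: indep_vars_def2)
  qed
qed

lemma (in prob_space) prob_distr_eq:
  assumes "distr M borel Y = distr M borel Z"
    and "Y \<in> borel_measurable M" "Z \<in> borel_measurable M" "A \<in> sets borel"
  shows "\<P>(\<omega> in M. Y \<omega> \<in> A) = \<P>(\<omega> in M. Z \<omega> \<in> A)"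
proof -
  have "measure (distr M borel Y) A = measure (distr M borel Z) A" by (simp add: assms(1))
  then show ?thesis using assms(2-)
    by (simp add: measure_distr vimage_def Int_def conj_commute)
qed

text \<open>Conditions under which a process on the half-line is almost surely bounded below at the dyadic times.
A Levy process plus a linear drift satisfies them in both directions of time: the regularity of the
paths enters only through an upper bound on the unit interval, which holds for the left-continuous
reversed paths too.\<close>
locale drift_process = prob_space +
  fixes U :: "real \<Rightarrow> 'a \<Rightarrow> real"
  assumes meas [measurable]: "\<And>t. U t \<in> borel_measurable M"
    and zero: "\<And>\<omega>. \<omega> \<in> space M \<Longrightarrow> U 0 \<omega> = 0"
    and stat: "\<And>s t. 0 \<le> s \<Longrightarrow> s \<le> t \<Longrightarrow>
                distr M borel (\<lambda>\<omega>. U t \<omega> - U s \<omega>) = distr M borel (U (t - s))"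
    and indep: "\<And>n t. mono t \<Longrightarrow> 0 \<le> t 0 \<Longrightarrow>
                indep_vars (\<lambda>_. borel) (\<lambda>i \<omega>. U (t (Suc i)) \<omega> - U (t i) \<omega>) {..<n::nat}"
    and loc: "\<And>\<omega>. \<omega> \<in> space M \<Longrightarrow> \<exists>B. \<forall>r\<in>{0..1}. U r \<omega> \<le> B"
    and int: "integrable M (U 1)" and pos: "expectation (U 1) > 0"
begin

lemma bdd_below_integers: "AE \<omega> in M. \<exists>K. \<forall>n::nat. K \<le> U (real n) \<omega>"
proof -
  define \<xi> where "\<xi> i \<omega> = U (real (Suc i)) \<omega> - U (real i) \<omega>" for i \<omega>
  have ident: "distr M borel (\<xi> i) = distr M borel (U 1)" for i
    using stat[of "real i" "real (Suc i)"] by (simp add: \<xi>_def[abs_def])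
  have m: "\<xi> i \<in> borel_measurable M" for i unfolding \<xi>_def[abs_def] by measurable
  have "AE \<omega> in M. \<exists>K. \<forall>n. K \<le> (\<Sum>i<n. \<xi> i \<omega>)"
  proof (rule iid_walk_bdd_below)
    show "indep_vars (\<lambda>_. borel) \<xi> UNIV"
      unfolding \<xi>_def[abs_def]
      by (rule indep_vars_nat_UNIV, rule indep[of real]) (auto simp: mono_def)
    show "distr M borel (\<xi> i) = distr M borel (\<xi> 0)" for i by (simp only: ident)
    have "integrable (distr M borel (\<xi> 0)) (\<lambda>x. x)"
      unfolding ident using int by (simp add: integrable_distr_eq)
    then show "integrable M (\<xi> 0)" using m[of 0] by (simp add: integrable_distr_eq)
    have "expectation (\<xi> 0) = (\<integral>x. x \<partial>distr M borel (\<xi> 0))" using m[of 0] by (simp add: integral_distr)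
    also have "\<dots> = expectation (U 1)" unfolding ident by (simp add: integral_distr)
    finally show "expectation (\<xi> 0) > 0" using pos by simp
  qed
  then show ?thesis
  proof (rule AE_mp, intro AE_I2 impI)
    fix \<omega> assume \<omega>: "\<omega> \<in> space M" and "\<exists>K. \<forall>n. K \<le> (\<Sum>i<n. \<xi> i \<omega>)"
    moreover have "(\<Sum>i<n. \<xi> i \<omega>) = U (real n) \<omega>" for n
      unfolding \<xi>_def using sum_lessThan_telescope[of "\<lambda>i. U (real i) \<omega>" n] zero[OF \<omega>] by simp
    ultimately show "\<exists>K. \<forall>n::nat. K \<le> U (real n) \<omega>" by simp
  qed
qed

text \<open>The suprema over dyadic times in the unit interval are finite, hence one constant bounds them with
probability at least one half.\<close>
lemma uniform_median:
  obtains c :: real where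
    "\<And>N i. real i / 2 ^ N \<le> 1 \<Longrightarrow> 1 / 2 \<le> \<P>(\<omega> in M. U (real i / 2 ^ N) \<omega> \<le> c)"
proof -
  define H where "H c = {\<omega> \<in> space M. \<forall>N i. real i / 2 ^ N \<le> 1 \<longrightarrow> U (real i / 2 ^ N) \<omega> \<le> real c}" for c :: nat
  have [measurable]: "H c \<in> sets M" for c unfolding H_def by measurable
  have "(\<lambda>c. prob (H c)) \<longlonglongrightarrow> prob (\<Union>c. H c)"
  proof (intro finite_Lim_measure_incseq)
    show "incseq H"
      unfolding incseq_def H_def
    proof (intro allI impI Collect_mono conjI, elim conjE)
      fix m n :: nat and \<omega> N i
      assume "m \<le> n" and *: "\<omega> \<in> space M \<and> (\<forall>N i. real i / 2 ^ N \<le> 1 \<longrightarrow> U (real i / 2 ^ N) \<omega> \<le> real m)"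
        "real i / 2 ^ N \<le> 1"
      then show "U (real i / 2 ^ N) \<omega> \<le> real n" by (meson of_nat_mono order_trans)
    qed blast
  qed auto
  moreover have "(\<Union>c. H c) = space M"
  proof (intro equalityI subsetI)
    fix \<omega> assume \<omega>: "\<omega> \<in> space M"
    obtain B where B: "\<And>r. r \<in> {0..1} \<Longrightarrow> U r \<omega> \<le> B" using loc[OF \<omega>] by blast
    obtain c :: nat where "B \<le> real c" using real_arch_simple by blast
    then have "\<omega> \<in> H c" using \<omega> B by (auto simp: H_def intro!: order_trans[OF B])
    then show "\<omega> \<in> (\<Union>c. H c)" by blast
  qed (auto simp: H_def)
  ultimately have "(\<lambda>c. prob (H c)) \<longlonglongrightarrow> 1" by (simp add: prob_space)
  then have "\<forall>\<^sub>F c in sequentially. 1 / 2 < prob (H c)" by (rule order_tendstoD) simp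
  then obtain c where c: "1 / 2 < prob (H c)" using eventually_happens'[OF sequentially_bot] by blast
  show thesis
  proof (rule that[of "real c"])
    fix N i :: nat assume "real i / 2 ^ N \<le> 1"
    then have "prob (H c) \<le> \<P>(\<omega> in M. U (real i / 2 ^ N) \<omega> \<le> real c)"
      by (intro finite_measure_mono) (auto simp: H_def)
    with c show "1 / 2 \<le> \<P>(\<omega> in M. U (real i / 2 ^ N) \<omega> \<le> real c)" by simp
  qed
qed

text \<open>The first passage event is a function of the increments up to time \<open>i / 2^N\<close>.\<close>
lemma first_passage_indep:
  fixes x c :: real and N i q :: nat
  assumes q: "real i / 2 ^ N \<le> real q"
  shows "\<P>(\<omega> in M. (U (real i / 2 ^ N) \<omega> \<le> x \<and> (\<forall>j<i. x < U (real j / 2 ^ N) \<omega>)) \<and> 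
                    U (real q) \<omega> - U (real i / 2 ^ N) \<omega> \<le> c)
       = \<P>(\<omega> in M. U (real i / 2 ^ N) \<omega> \<le> x \<and> (\<forall>j<i. x < U (real j / 2 ^ N) \<omega>)) * 
         \<P>(\<omega> in M. U (real q) \<omega> - U (real i / 2 ^ N) \<omega> \<le> c)"
proof -
  \<comment> \<open>The grid up to \<open>i\<close>, followed by one step to \<open>q\<close>, which carries the last increment.\<close>
  define s where "s j = (if j \<le> i then real j / 2 ^ N else real q)" for j
  define \<eta> where "\<eta> j \<omega> = U (s (Suc j)) \<omega> - U (s j) \<omega>" for j \<omega>
  have "mono s"
  proof (rule monoI)
    fix j k :: nat assume "j \<le> k"
    then have "real j / 2 ^ N \<le> real k / 2 ^ N" "j \<le> i \<Longrightarrow> real j / 2 ^ N \<le> real i / 2 ^ N"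
      by (auto intro!: divide_right_mono)
    with q \<open>j \<le> k\<close> show "s j \<le> s k" by (auto simp: s_def)
  qed
  then have ind: "indep_vars (\<lambda>_. borel) \<eta> {..<Suc i}"
    unfolding \<eta>_def by (rule indep) (simp add: s_def)
  have U_eq: "U (real j / 2 ^ N) \<omega> = (\<Sum>l<j. restrict (\<lambda>l. \<eta> l \<omega>) {..<i} l)" if "j \<le> i" "\<omega> \<in> space M" for j \<omega>
  proof -
    have "(\<Sum>l<j. restrict (\<lambda>l. \<eta> l \<omega>) {..<i} l) = (\<Sum>l<j. U (s (Suc l)) \<omega> - U (s l) \<omega>)"
      using that by (intro sum.cong) (auto simp: \<eta>_def)
    also have "\<dots> = U (s j) \<omega> - U (s 0) \<omega>" by (rule sum_lessThan_telescope)
    finally show ?thesis using that zero by (simp add: s_def)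
  qed
  define S where "S = {v \<in> space (Pi\<^sub>M {..<i} (\<lambda>_. borel)). (\<Sum>l<i. v l) \<le> x \<and> (\<forall>j<i. x < (\<Sum>l<j. v l))}"
  define T where "T = {v \<in> space (Pi\<^sub>M {i} (\<lambda>_. borel)). v i \<le> c}"
  have comp: "(\<lambda>v. v l) \<in> borel_measurable (Pi\<^sub>M {..<i} (\<lambda>_. borel))" if "l < i" for l
    by (rule measurable_component_singleton) (use that in simp)
  have S: "S \<in> sets (Pi\<^sub>M {..<i} (\<lambda>_. borel))"
  proof -
    have "Measurable.pred (Pi\<^sub>M {..<i} (\<lambda>_. borel)) (\<lambda>v. (\<Sum>l<i. v l) \<le> x \<and> (\<forall>j<i. x < (\<Sum>l<j. v l :: real)))"
      by (intro pred_intros_logic(3) borel_measurable_pred_le borel_measurable_sum comp borel_measurable_const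
           pred_intros_countable(1) pred_intros_imp' borel_measurable_pred_less) auto
    then show ?thesis by (simp add: S_def pred_def)
  qed
  have T: "T \<in> sets (Pi\<^sub>M {i} (\<lambda>_. borel))"
  proof -
    have "Measurable.pred (Pi\<^sub>M {i} (\<lambda>_. borel)) (\<lambda>v. v i \<le> c)"
      by (intro borel_measurable_pred_le measurable_component_singleton borel_measurable_const) auto
    then show ?thesis by (simp add: T_def pred_def)
  qed
  have E: "(\<lambda>l\<in>{..<i}. \<eta> l \<omega>) \<in> S \<longleftrightarrow> U (real i / 2 ^ N) \<omega> \<le> x \<and> (\<forall>j<i. x < U (real j / 2 ^ N) \<omega>)"
    if "\<omega> \<in> space M" for \<omega>
    using U_eq[OF _ that] by (auto simp: S_def space_PiM)
  have F: "(\<lambda>l\<in>{i}. \<eta> l \<omega>) \<in> T \<longleftrightarrow> U (real q) \<omega> - U (real i / 2 ^ N) \<omega> \<le> c" for \<omega>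
    by (simp add: T_def space_PiM \<eta>_def s_def)
  have "indep_var (Pi\<^sub>M {..<i} (\<lambda>_. borel)) (\<lambda>\<omega>. \<lambda>l\<in>{..<i}. \<eta> l \<omega>) (Pi\<^sub>M {i} (\<lambda>_. borel)) (\<lambda>\<omega>. \<lambda>l\<in>{i}. \<eta> l \<omega>)"
    by (rule indep_var_restrict[OF ind]) auto
  from indep_varD[OF this S T] show ?thesis
    using E F by (auto simp: vimage_def Int_def conj_commute cong: conj_cong)
qed

text \<open>Ottaviani's inequality. Once the process has fallen below \<open>x\<close> at a grid point, it does not rise by
more than \<open>c\<close> before the next integer with probability at least one half, independently of the past. So
the integers see at least half of the probability of falling low.\<close>
lemma ottaviani:
  assumes c: "\<And>N i. real i / 2 ^ N \<le> 1 \<Longrightarrow> 1 / 2 \<le> \<P>(\<omega> in M. U (real i / 2 ^ N) \<omega> \<le> c)"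
  shows "\<P>(\<omega> in M. \<exists>i<m::nat. U (real i / 2 ^ N) \<omega> \<le> x) \<le> 2 * \<P>(\<omega> in M. \<exists>n::nat. U (real n) \<omega> \<le> x + c)"
proof -
  define q where "q i = nat \<lceil>real i / 2 ^ N\<rceil>" for i
  have q: "real i / 2 ^ N \<le> real (q i)" "real (q i) \<le> real i / 2 ^ N + 1" for i
    by (auto simp: q_def of_nat_nat)
  define E where "E i = {\<omega> \<in> space M. U (real i / 2 ^ N) \<omega> \<le> x \<and> (\<forall>j<i. x < U (real j / 2 ^ N) \<omega>)}" for i
  define F where "F i = {\<omega> \<in> space M. (U (real i / 2 ^ N) \<omega> \<le> x \<and> (\<forall>j<i. x < U (real j / 2 ^ N) \<omega>)) \<and> 
                    U (real (q i)) \<omega> - U (real i / 2 ^ N) \<omega> \<le> c}" for i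
  have [measurable]: "E i \<in> sets M" "F i \<in> sets M" for i unfolding E_def F_def by measurable
  \<comment> \<open>The distance to the next integer is again dyadic and at most \<open>1\<close>.\<close>
  have half: "1 / 2 \<le> \<P>(\<omega> in M. U (real (q i)) \<omega> - U (real i / 2 ^ N) \<omega> \<le> c)" for i
  proof -
    have "real i \<le> real (q i) * 2 ^ N" using q(1)[of i] by (simp add: field_simps)
    then have le: "i \<le> q i * 2 ^ N"
      by (simp flip: of_nat_le_iff[where 'a = real])
    then have eq: "real (q i) - real i / 2 ^ N = real (q i * 2 ^ N - i) / 2 ^ N"
      by (simp add: of_nat_diff field_simps)
    have "\<P>(\<omega> in M. U (real (q i)) \<omega> - U (real i / 2 ^ N) \<omega> \<in> {..c}) = \<P>(\<omega> in M. U (real (q i) - real i / 2 ^ N) \<omega> \<in> {..c})"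
      using q by (intro prob_distr_eq stat) auto
    moreover have "real (q i * 2 ^ N - i) / 2 ^ N \<le> 1" using q(2)[of i] by (simp flip: eq)
    ultimately show ?thesis using c[of "q i * 2 ^ N - i" N] by (simp add: eq)
  qed
  have EF: "prob (E i) \<le> 2 * prob (F i)" for i
  proof -
    have "prob (F i) = prob (E i) * \<P>(\<omega> in M. U (real (q i)) \<omega> - U (real i / 2 ^ N) \<omega> \<le> c)"
      unfolding E_def F_def by (rule first_passage_indep[OF q(1)])
    moreover have "prob (E i) * (1 / 2) \<le> prob (E i) * \<P>(\<omega> in M. U (real (q i)) \<omega> - U (real i / 2 ^ N) \<omega> \<le> c)"
      by (intro mult_left_mono half) simp
    ultimately show ?thesis by simp
  qed
  have "{\<omega> \<in> space M. \<exists>i<m. U (real i / 2 ^ N) \<omega> \<le> x} \<subseteq> (\<Union>i<m. E i)"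
  proof
    fix \<omega> assume *: "\<omega> \<in> {\<omega> \<in> space M. \<exists>i<m. U (real i / 2 ^ N) \<omega> \<le> x}"
    define i where "i = (LEAST i. U (real i / 2 ^ N) \<omega> \<le> x)"
    obtain k where k: "k < m" "U (real k / 2 ^ N) \<omega> \<le> x" using * by blast
    then have "U (real i / 2 ^ N) \<omega> \<le> x" "i \<le> k" unfolding i_def by (auto intro: LeastI Least_le)
    moreover have "x < U (real j / 2 ^ N) \<omega>" if "j < i" for j
      using not_less_Least[OF that[unfolded i_def]] by simp
    ultimately show "\<omega> \<in> (\<Union>i<m. E i)" using * k by (auto simp: E_def intro!: bexI[of _ i])
  qed
  then have "\<P>(\<omega> in M. \<exists>i<m::nat. U (real i / 2 ^ N) \<omega> \<le> x) \<le> prob (\<Union>i<m. E i)"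
    by (intro finite_measure_mono) auto
  also have "\<dots> \<le> (\<Sum>i<m. prob (E i))" by (intro finite_measure_subadditive_finite) auto
  also have "\<dots> \<le> (\<Sum>i<m. 2 * prob (F i))" by (intro sum_mono EF)
  also have "\<dots> = 2 * prob (\<Union>i<m. F i)"
  proof -
    have "disjoint_family_on F {..<m}"
      unfolding disjoint_family_on_def
    proof (intro ballI impI)
      fix i j :: nat assume "i \<noteq> j"
      then show "F i \<inter> F j = {}" by (cases i j rule: linorder_cases) (auto simp: F_def not_le[symmetric])
    qed
    then have "prob (\<Union>i<m. F i) = (\<Sum>i<m. prob (F i))"
      by (intro finite_measure_finite_Union) auto
    then show ?thesis by (simp add: sum_distrib_left)
  qed
  also have "prob (\<Union>i<m. F i) \<le> \<P>(\<omega> in M. \<exists>n::nat. U (real n) \<omega> \<le> x + c)"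
  proof (intro finite_measure_mono subsetI)
    fix \<omega> assume "\<omega> \<in> (\<Union>i<m. F i)"
    then obtain i where "\<omega> \<in> F i" by blast
    then have "\<omega> \<in> space M" "U (real (q i)) \<omega> \<le> x + c" by (auto simp: F_def)
    then show "\<omega> \<in> {\<omega> \<in> space M. \<exists>n::nat. U (real n) \<omega> \<le> x + c}" by blast
  qed measurable
  finally show ?thesis by simp
qed

text \<open>Ottaviani's inequality bounds the probability of falling to \<open>-k\<close> at a dyadic time by twice that of
falling to \<open>-k + c\<close> at an integer, which vanishes as \<open>k\<close> grows.\<close>
lemma bdd_below_dyadics: "AE \<omega> in M. \<exists>K. \<forall>N i. K \<le> U (real i / 2 ^ N) \<omega>"
proof -
  obtain c where c: "\<And>N i. real i / 2 ^ N \<le> 1 \<Longrightarrow> 1 / 2 \<le> \<P>(\<omega> in M. U (real i / 2 ^ N) \<omega> \<le> c)"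
    using uniform_median by blast
  define \<beta> where "\<beta> k = \<P>(\<omega> in M. \<exists>n::nat. U (real n) \<omega> \<le> - real k + c)" for k :: nat
  define D where "D k N = {\<omega> \<in> space M. \<exists>i. U (real i / 2 ^ N) \<omega> \<le> - real k}" for k N :: nat
  have [measurable]: "D k N \<in> sets M" for k N unfolding D_def by measurable
  have D1: "prob (D k N) \<le> 2 * \<beta> k" for k N
  proof -
    define Dm where "Dm m = {\<omega> \<in> space M. \<exists>i<m. U (real i / 2 ^ N) \<omega> \<le> - real k}" for m
    have [measurable]: "Dm m \<in> sets M" for m unfolding Dm_def by measurable
    have "(\<lambda>m. prob (Dm m)) \<longlonglongrightarrow> prob (\<Union>m. Dm m)"
      by (intro finite_Lim_measure_incseq) (auto simp: incseq_def Dm_def intro: less_le_trans)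
    moreover have "(\<Union>m. Dm m) = D k N" by (auto simp: Dm_def D_def)
    moreover have "prob (Dm m) \<le> 2 * \<beta> k" for m
      unfolding Dm_def \<beta>_def by (rule ottaviani[OF c])
    ultimately show ?thesis by (auto intro: LIMSEQ_le_const2)
  qed
  have D2: "prob (\<Union>N. D k N) \<le> 2 * \<beta> k" for k
  proof -
    have "incseq (D k)"
    proof (rule incseq_SucI)
      fix N
      have "U (real i / 2 ^ N) \<omega> = U (real (2 * i) / 2 ^ Suc N) \<omega>" for i \<omega> by simp
      then show "D k N \<subseteq> D k (Suc N)"
        unfolding D_def by (intro Collect_mono) (metis (no_types))
    qed
    then have "(\<lambda>N. prob (D k N)) \<longlonglongrightarrow> prob (\<Union>N. D k N)"
      by (intro finite_Lim_measure_incseq) auto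
    then show ?thesis by (rule LIMSEQ_le_const2) (use D1 in auto)
  qed
  have lim: "\<beta> \<longlonglongrightarrow> 0"
  proof -
    define B where "B k = {\<omega> \<in> space M. \<exists>n::nat. U (real n) \<omega> \<le> - real k + c}" for k :: nat
    have [measurable]: "B k \<in> sets M" for k unfolding B_def by measurable
    have "(\<lambda>k. prob (B k)) \<longlonglongrightarrow> prob (\<Inter>k. B k)"
    proof (intro finite_Lim_measure_decseq)
      show "decseq B"
        unfolding decseq_def B_def
      proof (intro allI impI Collect_mono conjI, elim conjE exE)
        fix m k :: nat and \<omega> assume "m \<le> k" "\<omega> \<in> space M \<and> (\<exists>n::nat. U (real n) \<omega> \<le> - real k + c)"
        then obtain n :: nat where "U (real n) \<omega> \<le> - real k + c" by blast
        moreover have "real m \<le> real k" using \<open>m \<le> k\<close> by simp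
        ultimately have "U (real n) \<omega> \<le> - real m + c" by linarith
        then show "\<exists>n::nat. U (real n) \<omega> \<le> - real m + c" by blast
      qed blast
    qed auto
    moreover have "prob (\<Inter>k. B k) = 0"
    proof -
      have "AE \<omega> in M. \<omega> \<notin> (\<Inter>k. B k)"
        using bdd_below_integers
      proof eventually_elim
        case (elim \<omega>)
        then obtain K where K: "\<And>n::nat. K \<le> U (real n) \<omega>" by blast
        obtain k :: nat where k: "c - K < real k" using reals_Archimedean2 by blast
        have "\<omega> \<notin> B k"
        proof
          assume "\<omega> \<in> B k"
          then obtain n :: nat where "U (real n) \<omega> \<le> - real k + c" by (auto simp: B_def)
          with K[of n] k show False by simp
        qed
        then show ?case by blast
      qed
      then have "AE \<omega> in M. (\<omega> \<in> (\<Inter>k. B k)) = (\<omega> \<in> {})" by eventually_elim simp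
      then have "prob (\<Inter>k. B k) = prob {}" by (rule finite_measure_eq_AE) auto
      then show ?thesis by simp
    qed
    ultimately show ?thesis by (simp add: \<beta>_def[abs_def] B_def)
  qed
  define Bad where "Bad = (\<Inter>k. \<Union>N. D k N)"
  have [measurable]: "Bad \<in> sets M" unfolding Bad_def by measurable
  have "prob Bad \<le> 2 * \<beta> k" for k
    by (rule order_trans[OF _ D2[of k]], rule finite_measure_mono) (auto simp: Bad_def)
  moreover have "(\<lambda>k. 2 * \<beta> k) \<longlonglongrightarrow> 2 * 0" by (intro tendsto_intros lim)
  ultimately have "prob Bad \<le> 0" by (intro LIMSEQ_le_const[of "\<lambda>k. 2 * \<beta> k" "2 * 0" "prob Bad", simplified]) auto
  then have "prob Bad = 0" by (simp add: measure_le_0_iff)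
  then have "AE \<omega> in M. \<omega> \<notin> Bad"
    by (subst AE_iff_measurable[OF \<open>Bad \<in> sets M\<close>]) (use sets.sets_into_space[OF \<open>Bad \<in> sets M\<close>] in \<open>auto simp: emeasure_eq_measure\<close>)
  then show ?thesis
  proof (rule AE_mp, intro AE_I2 impI)
    fix \<omega> assume "\<omega> \<in> space M" "\<omega> \<notin> Bad"
    then obtain k where "\<And>N i. - real k < U (real i / 2 ^ N) \<omega>"
      by (auto simp: Bad_def D_def not_le)
    then show "\<exists>K. \<forall>N i. K \<le> U (real i / 2 ^ N) \<omega>" by (auto intro!: exI[of _ "- real k"] less_imp_le)
  qed
qed

end

lemma distr_eq_compose:
  assumes "distr M borel Y = distr M borel Z" "Y \<in> borel_measurable M" "Z \<in> borel_measurable M"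
    and "f \<in> borel_measurable borel"
  shows "distr M borel (\<lambda>\<omega>. f (Y \<omega>)) = distr M borel (\<lambda>\<omega>. f (Z \<omega>))"
proof -
  have "distr (distr M borel Y) borel f = distr (distr M borel Z) borel f" by (simp add: assms(1))
  then show ?thesis using assms(2-) by (simp add: distr_distr o_def)
qed

lemma integrable_distr_cong:
  fixes Y Z :: "'a \<Rightarrow> real"
  assumes "distr M borel Y = distr M borel Z" "Y \<in> borel_measurable M" "Z \<in> borel_measurable M"
  shows "integrable M Y \<longleftrightarrow> integrable M Z" "integral\<^sup>L M Y = integral\<^sup>L M Z"
proof -
  have "integrable (distr M borel Y) (\<lambda>x. x) \<longleftrightarrow> integrable (distr M borel Z) (\<lambda>x. x)" by (simp add: assms(1))
  then show "integrable M Y \<longleftrightarrow> integrable M Z" using assms(2-) by (simp add: integrable_distr_eq)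
  have "integral\<^sup>L (distr M borel Y) (\<lambda>x. x) = integral\<^sup>L (distr M borel Z) (\<lambda>x. x)" by (simp add: assms(1))
  then show "integral\<^sup>L M Y = integral\<^sup>L M Z" using assms(2-) by (simp add: integral_distr)
qed

context two_sided_levy_process
begin

declare measurable_X [measurable]

lemma distr_increment:
  assumes "s \<le> t"
  shows "distr P borel (\<lambda>\<omega>. X t \<omega> - X s \<omega>) = distr P borel (X (t - s))"
proof -
  have "distr P borel (\<lambda>\<omega>. X t \<omega> - X s \<omega>) = distr P borel (\<lambda>\<omega>. X (t + - s) \<omega> - X (s + - s) \<omega>)"
    using assms by (rule stationary_increments[symmetric])
  also have "\<dots> = distr P borel (X (t - s))"
    by (rule distr_cong) (simp_all add: zero_at_0)
  finally show ?thesis .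
qed

text \<open>Reversed in time, the increments are the negatives of increments along an increasing sequence.\<close>
lemma indep_increments_reversed:
  fixes t :: "nat \<Rightarrow> real"
  assumes "mono t"
  shows "indep_vars (\<lambda>_. borel) (\<lambda>i \<omega>. X (- t (Suc i)) \<omega> - X (- t i) \<omega>) {..<n::nat}"
proof -
  \<comment> \<open>Truncated subtraction makes the sequence constant from index \<open>n\<close> on, so it stays monotone.\<close>
  define s where "s j = - t (n - j)" for j
  define \<eta> where "\<eta> j \<omega> = X (s (Suc j)) \<omega> - X (s j) \<omega>" for j \<omega>
  have "mono s" unfolding s_def by (intro monoI) (auto intro!: monoD[OF assms])
  then have "indep_vars (\<lambda>_. borel) \<eta> {..<n}"
    unfolding \<eta>_def by (rule independent_increments)
  then have "indep_vars (\<lambda>j. Pi\<^sub>M {n - Suc j} (\<lambda>_. borel)) (\<lambda>j \<omega>. restrict (\<lambda>i. \<eta> i \<omega>) {n - Suc j}) {..<n}"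
    by (rule indep_vars_restrict) (auto simp: disjoint_family_on_def)
  then have "indep_vars (\<lambda>_. borel) (\<lambda>j \<omega>. - (restrict (\<lambda>i. \<eta> i \<omega>) {n - Suc j} (n - Suc j))) {..<n}"
    by (rule indep_vars_compose2[where Y = "\<lambda>j v. - v (n - Suc j)"])
       (intro borel_measurable_uminus measurable_component_singleton, simp)
  then show ?thesis
    by (rule indep_vars_cong[THEN iffD1, rotated -1])
       (auto simp: \<eta>_def s_def Suc_diff_Suc fun_eq_iff)
qed

lemma drift_process_forward:
  assumes int: "integrable P (X 1)" and a: "- expectation (X 1) < a"
  shows "drift_process P (\<lambda>t \<omega>. X t \<omega> + a * t)"
proof
  show "distr P borel (\<lambda>\<omega>. X t \<omega> + a * t - (X s \<omega> + a * s)) = distr P borel (\<lambda>\<omega>. X (t - s) \<omega> + a * (t - s))"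
    if "0 \<le> s" "s \<le> t" for s t
    using distr_eq_compose[OF distr_increment[OF that(2)], of "\<lambda>y. y + a * (t - s)"]
    by (simp add: algebra_simps)
  show "indep_vars (\<lambda>_. borel) (\<lambda>i \<omega>. X (t (Suc i)) \<omega> + a * t (Suc i) - (X (t i) \<omega> + a * t i)) {..<n}"
    if "mono t" for n :: nat and t :: "nat \<Rightarrow> real"
    using indep_vars_compose2[OF independent_increments[OF that, of n],
        of "\<lambda>i y. y + a * (t (Suc i) - t i)" "\<lambda>_. borel"]
    by (simp add: algebra_simps)
  show "\<exists>B. \<forall>r\<in>{0..1}. X r \<omega> + a * r \<le> B" if \<omega>: "\<omega> \<in> space P" for \<omega>
  proof -
    obtain B where B: "\<And>r. r \<in> {0..1} \<Longrightarrow> \<bar>X r \<omega>\<bar> \<le> B"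
      using cadlag_bounded[OF cadlag_paths[OF \<omega>], of 0 1] by blast
    have "X r \<omega> + a * r \<le> B + \<bar>a\<bar>" if "r \<in> {0..1}" for r
    proof -
      have "a * r \<le> \<bar>a\<bar> * 1" using that by (intro mult_mono) auto
      then show ?thesis using B[OF that] by linarith
    qed
    then show ?thesis by blast
  qed
qed (use int a in \<open>auto simp: zero_at_0 prob_space\<close>)

lemma drift_process_backward:
  assumes int: "integrable P (X 1)" and a: "expectation (X 1) < a"
  shows "drift_process P (\<lambda>t \<omega>. X (- t) \<omega> + a * t)"
proof
  show "distr P borel (\<lambda>\<omega>. X (- t) \<omega> + a * t - (X (- s) \<omega> + a * s)) = distr P borel (\<lambda>\<omega>. X (- (t - s)) \<omega> + a * (t - s))"
    if "0 \<le> s" "s \<le> t" for s t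
  proof -
    have "distr P borel (\<lambda>\<omega>. X (- s) \<omega> - X (- t) \<omega>) = distr P borel (\<lambda>\<omega>. X 0 \<omega> - X (- (t - s)) \<omega>)"
      using that distr_increment[of "-t" "-s"] distr_increment[of "- (t - s)" 0] by simp
    from distr_eq_compose[OF this, of "\<lambda>y. - y + a * (t - s)"]
    have "distr P borel (\<lambda>\<omega>. X (- t) \<omega> + a * t - (X (- s) \<omega> + a * s)) = distr P borel (\<lambda>\<omega>. X (- (t - s)) \<omega> - X 0 \<omega> + a * (t - s))"
      by (simp add: algebra_simps)
    also have "\<dots> = distr P borel (\<lambda>\<omega>. X (- (t - s)) \<omega> + a * (t - s))"
      by (rule distr_cong) (simp_all add: zero_at_0)
    finally show ?thesis .
  qed
  show "indep_vars (\<lambda>_. borel) (\<lambda>i \<omega>. X (- t (Suc i)) \<omega> + a * t (Suc i) - (X (- t i) \<omega> + a * t i)) {..<n}"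
    if "mono t" for n :: nat and t :: "nat \<Rightarrow> real"
    using indep_vars_compose2[OF indep_increments_reversed[OF that, of n],
        of "\<lambda>i y. y + a * (t (Suc i) - t i)" "\<lambda>_. borel"]
    by (simp add: algebra_simps)
  show "\<exists>B. \<forall>r\<in>{0..1}. X (- r) \<omega> + a * r \<le> B" if \<omega>: "\<omega> \<in> space P" for \<omega>
  proof -
    obtain B where B: "\<And>r. r \<in> {-1..0} \<Longrightarrow> \<bar>X r \<omega>\<bar> \<le> B"
      using cadlag_bounded[OF cadlag_paths[OF \<omega>], of "-1" 0] by blast
    have "X (- r) \<omega> + a * r \<le> B + \<bar>a\<bar>" if "r \<in> {0..1}" for r
    proof -
      have "a * r \<le> \<bar>a\<bar> * 1" using that by (intro mult_mono) auto
      then show ?thesis using B[of "- r"] that by (auto simp: abs_le_iff)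
    qed
    then show ?thesis by blast
  qed
  have eq: "distr P borel (\<lambda>\<omega>. - X (- 1) \<omega>) = distr P borel (X 1)"
  proof -
    have "distr P borel (\<lambda>\<omega>. - X (- 1) \<omega>) = distr P borel (\<lambda>\<omega>. X 0 \<omega> - X (- 1) \<omega>)"
      by (rule distr_cong) (simp_all add: zero_at_0)
    then show ?thesis using distr_increment[of "-1" 0] by simp
  qed
  have "integrable P (\<lambda>\<omega>. - X (- 1) \<omega>)" using integrable_distr_cong(1)[OF eq] int by simp
  then have i: "integrable P (X (- 1))" by simp
  then show "integrable P (\<lambda>\<omega>. X (- 1) \<omega> + a * 1)" by simp
  have "- expectation (X (- 1)) = expectation (X 1)" using integrable_distr_cong(2)[OF eq] by simp
  then show "0 < expectation (\<lambda>\<omega>. X (- 1) \<omega> + a * 1)" using i a by (simp add: prob_space)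
qed (auto simp: zero_at_0)

lemma linear_lower_bound:
  assumes int: "integrable P (X 1)" and a: "\<bar>expectation (X 1)\<bar> < a"
  shows "AE \<omega> in P. \<exists>K. \<forall>s. K \<le> X s \<omega> + a * \<bar>s\<bar>"
proof -
  interpret f: drift_process P "\<lambda>t \<omega>. X t \<omega> + a * t" using int a by (intro drift_process_forward) auto
  interpret b: drift_process P "\<lambda>t \<omega>. X (- t) \<omega> + a * t" using int a by (intro drift_process_backward) auto
  have "AE \<omega> in P. \<omega> \<in> space P" by simp
  then show ?thesis using f.bdd_below_dyadics b.bdd_below_dyadics
  proof eventually_elim
    case (elim \<omega>)
    then obtain K1 K2 where K1: "\<And>N i. K1 \<le> X (real i / 2 ^ N) \<omega> + a * (real i / 2 ^ N)"
      and K2: "\<And>N i. K2 \<le> X (- (real i / 2 ^ N)) \<omega> + a * (real i / 2 ^ N)" by blast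
    have dyadic: "min K1 K2 \<le> X (of_int z / 2 ^ k) \<omega> + a * \<bar>of_int z / 2 ^ k\<bar>" for z :: int and k
    proof (cases "z \<ge> 0")
      case True
      then show ?thesis using K1[of "nat z" k] by simp
    next
      case False
      then show ?thesis using K2[of "nat (- z)" k] by simp
    qed
    have "min K1 K2 \<le> X s \<omega> + a * \<bar>s\<bar>" for s
    proof (rule tendsto_lowerbound)
      show "(\<lambda>k. X (dyadic_above k s) \<omega> + a * \<bar>dyadic_above k s\<bar>) \<longlonglongrightarrow> X s \<omega> + a * \<bar>s\<bar>"
        using dyadic_above_tendsto[of s] cadlag_dyadic_above[OF cadlag_paths[OF elim(1)], of s]
        by (intro tendsto_add tendsto_mult tendsto_rabs tendsto_const) (simp_all add: filterlim_at)
      show "\<forall>\<^sub>F k in sequentially. min K1 K2 \<le> X (dyadic_above k s) \<omega> + a * \<bar>dyadic_above k s\<bar>"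
        using dyadic[of "\<lfloor>2 ^ _ * s\<rfloor> + 1"] unfolding dyadic_above_def by simp
    qed simp
    then show ?case by blast
  qed
qed

lemma levy_uminus: "two_sided_levy_process P (\<lambda>t \<omega>. - X t \<omega>)"
proof
  show "cadlag (\<lambda>t. - X t \<omega>)" if "\<omega> \<in> space P" for \<omega>
    unfolding cadlag_def continuous_within
  proof (intro allI conjI)
    fix t
    show "((\<lambda>t. - X t \<omega>) \<longlongrightarrow> - X t \<omega>) (at_right t)"
      by (intro tendsto_minus cadlag_right[of "\<lambda>t. X t \<omega>"] cadlag_paths that)
    show "\<exists>l. ((\<lambda>t. - X t \<omega>) \<longlongrightarrow> l) (at_left t)"
      using cadlag_left[OF cadlag_paths[OF that], of t] tendsto_minus by blast
  qed
  show "distr P borel (\<lambda>\<omega>. - X (t + h) \<omega> - - X (s + h) \<omega>) = distr P borel (\<lambda>\<omega>. - X t \<omega> - - X s \<omega>)"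
    if "s \<le> t" for s t h
    using distr_eq_compose[OF stationary_increments[OF that, of h], of uminus] by (simp add: algebra_simps)
  show "indep_vars (\<lambda>_. borel) (\<lambda>i \<omega>. - X (t (Suc i)) \<omega> - - X (t i) \<omega>) {..<n}"
    if "mono t" for n :: nat and t :: "nat \<Rightarrow> real"
    using indep_vars_compose2[OF independent_increments[OF that, of n], of "\<lambda>i. uminus" "\<lambda>_. borel"]
    by (simp add: algebra_simps)
qed (auto simp: zero_at_0)

text \<open>The process and its negative both satisfy the lower bound.\<close>
lemma linear_growth:
  assumes int: "integrable P (X 1)" and a: "\<bar>expectation (X 1)\<bar> < a"
  shows "AE \<omega> in P. \<exists>K. \<forall>s. \<bar>X s \<omega>\<bar> \<le> a * \<bar>s\<bar> + K"
proof -
  interpret neg: two_sided_levy_process P "\<lambda>t \<omega>. - X t \<omega>" by (rule levy_uminus)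
  have "AE \<omega> in P. \<exists>K. \<forall>s. K \<le> - X s \<omega> + a * \<bar>s\<bar>"
    using int a by (intro neg.linear_lower_bound) auto
  with linear_lower_bound[OF assms] show ?thesis
  proof eventually_elim
    case (elim \<omega>)
    then obtain K1 K2 where "\<And>s. K1 \<le> X s \<omega> + a * \<bar>s\<bar>" "\<And>s. K2 \<le> - X s \<omega> + a * \<bar>s\<bar>" by blast
    then have "\<bar>X s \<omega>\<bar> \<le> a * \<bar>s\<bar> + (\<bar>K1\<bar> + \<bar>K2\<bar>)" for s by (smt (verit))
    then show ?case by blast
  qed
qed

section \<open>Invariance of the law under shifts\<close>

definition sample_path :: "'a \<Rightarrow> real \<Rightarrow> real" where "sample_path \<omega> = (\<lambda>t. X t \<omega>)"

lemma measurable_sample_path [measurable]: "sample_path \<in> measurable P path_space"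
  by (rule measurable_path_spaceI) (auto simp: sample_path_def cadlag_paths)

lemma measurable_shift_sample_path [measurable]: "(\<lambda>\<omega>. shift_path u (sample_path \<omega>)) \<in> measurable P path_space"
  by (rule measurable_shift) auto

text \<open>Along the sorted times, the increments of the shifted and of the original process are independent
families with equal marginals, hence equal in law, and both processes are recovered from them by
partial sums.\<close>
lemma finite_dim_shift:
  fixes J :: "real set" and A :: "real \<Rightarrow> real set"
  assumes J: "finite J" and A: "\<And>j. j \<in> J \<Longrightarrow> A j \<in> sets borel"
  shows "emeasure P {\<omega> \<in> space P. \<forall>j\<in>J. X (j + u) \<omega> - X u \<omega> \<in> A j} =
         emeasure P {\<omega> \<in> space P. \<forall>j\<in>J. X j \<omega> \<in> A j}"
proof -
  \<comment> \<open>The time \<open>0\<close> is included because \<open>X j = X j - X 0\<close>.\<close>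
  define L where "L = sorted_list_of_set (insert 0 J)"
  define m where "m = length L"
  have L: "set L = insert 0 J" "sorted L" using J unfolding L_def
    by (simp_all only: set_sorted_list_of_set sorted_sorted_list_of_set finite_insert)
  have "m > 0" using L by (auto simp: m_def)
  \<comment> \<open>Repeating the last time keeps the sequence monotone; it contributes a zero increment, which leaves
    the index set \<open>{..<m}\<close> nonempty even if \<open>0\<close> is the only time.\<close>
  define t where "t i = L ! min i (m - 1)" for i
  have "mono t" unfolding t_def
  proof (intro monoI sorted_nth_mono L)
    fix i j :: nat assume "i \<le> j"
    then show "min i (m - 1) \<le> min j (m - 1)" by simp
    have "min j (m - 1) \<le> m - 1" by simp
    then show "min j (m - 1) < length L" using \<open>m > 0\<close> unfolding m_def[symmetric] by linarith
  qed
  have "\<exists>k<m. t k = j" if "j \<in> insert 0 J" for j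
  proof -
    have "j \<in> set L" using that by (simp only: L)
    then obtain k where "k < m" "L ! k = j" unfolding in_set_conv_nth m_def by blast
    then show ?thesis by (intro exI[of _ k]) (simp add: t_def)
  qed
  then obtain \<kappa> where \<kappa>: "\<And>j. j \<in> insert 0 J \<Longrightarrow> \<kappa> j < m \<and> t (\<kappa> j) = j" by metis
  define inc where "inc u i \<omega> = X (t (Suc i) + u) \<omega> - X (t i + u) \<omega>" for u i \<omega>
  have [measurable]: "inc u i \<in> borel_measurable P" for u i unfolding inc_def[abs_def] by measurable
  have joint: "distr P (Pi\<^sub>M {..<m} (\<lambda>_. borel)) (\<lambda>\<omega>. \<lambda>i\<in>{..<m}. inc u i \<omega>) = Pi\<^sub>M {..<m} (\<lambda>i. distr P borel (inc 0 i))" for u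
  proof -
    have "mono (\<lambda>i. t i + u)" using \<open>mono t\<close> by (auto simp: mono_def)
    from independent_increments[OF this, of m]
    have "indep_vars (\<lambda>_. borel) (inc u) {..<m}" by (simp add: inc_def[abs_def])
    then have "distr P (Pi\<^sub>M {..<m} (\<lambda>_. borel)) (\<lambda>\<omega>. \<lambda>i\<in>{..<m}. inc u i \<omega>) = Pi\<^sub>M {..<m} (\<lambda>i. distr P borel (inc u i))"
      using indep_vars_iff_distr_eq_PiM[where I = "{..<m}" and X = "inc u" and M' = "\<lambda>_. borel"] \<open>m > 0\<close>
      by (auto simp: lessThan_empty_iff)
    moreover have "distr P borel (inc u i) = distr P borel (inc 0 i)" for i
      using stationary_increments[OF monoD[OF \<open>mono t\<close>, of i "Suc i"], of u] by (simp add: inc_def[abs_def])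
    ultimately show ?thesis by simp
  qed
  define S where "S = {v \<in> space (Pi\<^sub>M {..<m} (\<lambda>_. borel)). \<forall>j\<in>J. (\<Sum>i<\<kappa> j. v i) - (\<Sum>i<\<kappa> 0. v i) \<in> A j}"
  have comp: "(\<lambda>v. v i) \<in> borel_measurable (Pi\<^sub>M {..<m} (\<lambda>_. borel))" if "i < m" for i
    by (rule measurable_component_singleton) (use that in simp)
  have partial_sum: "(\<lambda>v. \<Sum>i<k. v i) \<in> borel_measurable (Pi\<^sub>M {..<m} (\<lambda>_. borel :: real measure))" if "k < m" for k
    by (rule borel_measurable_sum) (use that in \<open>auto intro!: comp\<close>)
  have S: "S \<in> sets (Pi\<^sub>M {..<m} (\<lambda>_. borel))"
  proof -
    have "Measurable.pred (Pi\<^sub>M {..<m} (\<lambda>_. borel)) (\<lambda>v. (\<Sum>i<\<kappa> j. v i) - (\<Sum>i<\<kappa> 0. v i) \<in> A j)" if "j \<in> J" for j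
    proof (rule pred_sets2[OF A[OF that]])
      show "(\<lambda>v. (\<Sum>i<\<kappa> j. v i) - (\<Sum>i<\<kappa> 0. v i) :: real) \<in> borel_measurable (Pi\<^sub>M {..<m} (\<lambda>_. borel))"
        by (intro borel_measurable_diff partial_sum \<kappa>[THEN conjunct1]) (use that in auto)
    qed
    then have "Measurable.pred (Pi\<^sub>M {..<m} (\<lambda>_. borel)) (\<lambda>v. \<forall>j\<in>J. (\<Sum>i<\<kappa> j. v i) - (\<Sum>i<\<kappa> 0. v i) \<in> A j)"
      by (intro pred_intros_finite(3) J)
    then show ?thesis by (simp add: S_def pred_def)
  qed
  have ev: "{\<omega> \<in> space P. \<forall>j\<in>J. X (j + u) \<omega> - X u \<omega> \<in> A j}
      = (\<lambda>\<omega>. \<lambda>i\<in>{..<m}. inc u i \<omega>) -` S \<inter> space P" for u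
  proof -
    have tel: "(\<Sum>i<\<kappa> j. (\<lambda>i\<in>{..<m}. inc u i \<omega>) i) = X (j + u) \<omega> - X (t 0 + u) \<omega>" if "j \<in> insert 0 J" for j \<omega>
    proof -
      have "(\<Sum>i<\<kappa> j. (\<lambda>i\<in>{..<m}. inc u i \<omega>) i) = (\<Sum>i<\<kappa> j. X (t (Suc i) + u) \<omega> - X (t i + u) \<omega>)"
        using \<kappa>[OF that] by (intro sum.cong) (auto simp: inc_def)
      also have "\<dots> = X (t (\<kappa> j) + u) \<omega> - X (t 0 + u) \<omega>"
        by (rule sum_lessThan_telescope[of "\<lambda>i. X (t i + u) \<omega>"])
      finally show ?thesis using \<kappa>[OF that] by simp
    qed
    have "X (j + u) \<omega> - X u \<omega> = (\<Sum>i<\<kappa> j. (\<lambda>i\<in>{..<m}. inc u i \<omega>) i) - (\<Sum>i<\<kappa> 0. (\<lambda>i\<in>{..<m}. inc u i \<omega>) i)"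
      if "j \<in> J" for j \<omega>
      using tel[of j \<omega>] tel[of 0 \<omega>] that by simp
    then show ?thesis by (auto simp: S_def space_PiM simp del: restrict_apply)
  qed
  have "emeasure P {\<omega> \<in> space P. \<forall>j\<in>J. X (j + u) \<omega> - X u \<omega> \<in> A j}
      = emeasure (Pi\<^sub>M {..<m} (\<lambda>i. distr P borel (inc 0 i))) S" for u
    unfolding ev joint[of u, symmetric] by (subst emeasure_distr[OF _ S]) auto
  from this[of u] this[of 0]
  have "emeasure P {\<omega> \<in> space P. \<forall>j\<in>J. X (j + u) \<omega> - X u \<omega> \<in> A j} =
    emeasure P {\<omega> \<in> space P. \<forall>j\<in>J. X (j + 0) \<omega> - X 0 \<omega> \<in> A j}" by simp
  also have "{\<omega> \<in> space P. \<forall>j\<in>J. X (j + 0) \<omega> - X 0 \<omega> \<in> A j} = {\<omega> \<in> space P. \<forall>j\<in>J. X j \<omega> \<in> A j}"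
    by (auto simp: zero_at_0)
  finally show ?thesis .
qed

lemma law_shift: "distr P path_space (\<lambda>\<omega>. shift_path u (sample_path \<omega>)) = distr P path_space sample_path"
proof -
  let ?B = "Pi\<^sub>M UNIV (\<lambda>_::real. borel :: real measure)"
  have meas: "p \<in> measurable P ?B" if "p \<in> measurable P path_space" for p
    by (intro measurable_PiM_single' measurable_eval_const that) (auto simp: space_PiM)
  have "distr P ?B (\<lambda>\<omega>. shift_path u (sample_path \<omega>)) = distr P ?B sample_path"
  proof (rule measure_eqI_PiM_infinite)
    fix A :: "real \<Rightarrow> real set" and J assume J: "finite J" and A: "\<And>i. i \<in> J \<Longrightarrow> A i \<in> sets borel"
    have emb: "prod_emb UNIV (\<lambda>_. borel) J (Pi\<^sub>E J A) \<in> sets ?B" using J A by (intro sets_PiM_I) auto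
    have *: "emeasure (distr P ?B p) (prod_emb UNIV (\<lambda>_. borel) J (Pi\<^sub>E J A)) = emeasure P {\<omega> \<in> space P. \<forall>j\<in>J. p \<omega> j \<in> A j}"
      if p: "p \<in> measurable P path_space" for p
      by (subst emeasure_distr[OF meas[OF p] emb])
         (auto simp: prod_emb_def intro!: arg_cong[where f = "emeasure P"])
    have "emeasure P {\<omega> \<in> space P. \<forall>j\<in>J. shift_path u (sample_path \<omega>) j \<in> A j} = emeasure P {\<omega> \<in> space P. \<forall>j\<in>J. sample_path \<omega> j \<in> A j}"
      using finite_dim_shift[OF J, of A u] A by (simp add: shift_path_def sample_path_def)
    then show "emeasure (distr P ?B (\<lambda>\<omega>. shift_path u (sample_path \<omega>))) (prod_emb UNIV (\<lambda>_. borel) J (Pi\<^sub>E J A))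
         = emeasure (distr P ?B sample_path) (prod_emb UNIV (\<lambda>_. borel) J (Pi\<^sub>E J A))"
      by (simp add: * measurable_sample_path measurable_shift_sample_path)
  next
    show "finite_measure (distr P ?B (\<lambda>\<omega>. shift_path u (sample_path \<omega>)))"
      by (intro prob_space.finite_measure prob_space_distr meas) measurable
  qed auto
  note eq = this
  show ?thesis
  proof (rule measure_eqI)
    fix A assume "A \<in> sets (distr P path_space (\<lambda>\<omega>. shift_path u (sample_path \<omega>)))"
    then have A: "A \<in> sets path_space" by simp
    then obtain B where B: "A = {x. cadlag x} \<inter> B" "B \<in> sets ?B"
      by (auto simp: path_space_def sets_restrict_space)
    have "emeasure (distr P path_space p) A = emeasure (distr P ?B p) B" if p: "p \<in> measurable P path_space" for p
    proof -
      have "p -` A \<inter> space P = p -` B \<inter> space P" using path_space_cadlag[OF p] B by auto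
      then show ?thesis using A B(2) meas[OF p] p by (simp add: emeasure_distr)
    qed
    then show "emeasure (distr P path_space (\<lambda>\<omega>. shift_path u (sample_path \<omega>))) A = emeasure (distr P path_space sample_path) A"
      by (simp add: eq)
  qed simp
qed

lemma nn_integral_shift:
  assumes F: "F \<in> borel_measurable path_space"
  shows "(\<integral>\<^sup>+\<omega>. F (shift_path u (sample_path \<omega>)) \<partial>P) = (\<integral>\<^sup>+\<omega>. F (sample_path \<omega>) \<partial>P)"
proof -
  have "(\<integral>\<^sup>+\<omega>. F (shift_path u (sample_path \<omega>)) \<partial>P) = (\<integral>\<^sup>+x. F x \<partial>distr P path_space (\<lambda>\<omega>. shift_path u (sample_path \<omega>)))"
    using F by (subst nn_integral_distr) auto
  also have "\<dots> = (\<integral>\<^sup>+\<omega>. F (sample_path \<omega>) \<partial>P)"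
    unfolding law_shift using F by (subst nn_integral_distr) auto
  finally show ?thesis .
qed

end

section \<open>Mass transport within a gap\<close>

lemma countable_if_closed_discrete:
  fixes Z :: "real set"
  assumes "closed Z" "topological_space_class.discrete Z"
  shows "countable Z"
proof -
  have "finite (Z \<inter> {- real n..real n})" for n
  proof -
    have "topological_space_class.discrete (Z \<inter> {- real n..real n})"
      by (rule discrete_subset[OF assms(2)]) simp
    moreover have "compact (Z \<inter> {- real n..real n})"
      using assms(1) by (intro closed_Int_compact) auto
    ultimately show ?thesis using discrete_compact_finite_iff[of "Z \<inter> {- real n..real n}"] by simp
  qed
  then have "countable (\<Union>n. Z \<inter> {- real n..real n})" 
    by (intro countable_UN) (simp_all add: countable_finite)
  moreover have "Z \<subseteq> (\<Union>n. Z \<inter> {- real n..real n})"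
  proof
    fix z assume "z \<in> Z"
    obtain n where "\<bar>z\<bar> \<le> real n" using real_arch_simple by blast
    with \<open>z \<in> Z\<close> show "z \<in> (\<Union>n. Z \<inter> {- real n..real n})" by (auto intro!: exI[of _ n])
  qed
  ultimately show ?thesis by (rule countable_subset[rotated])
qed

locale levy_contact = two_sided_levy_process +
  fixes \<alpha> :: real
  assumes \<alpha>: "\<alpha> > 0" and integrable_X1: "integrable P (X 1)" and drift: "\<bar>expectation (X 1)\<bar> < \<alpha>"
    and discrete: "AE \<omega> in P. topological_space_class.discrete (contact_set \<alpha> (sample_path \<omega>))"
begin

lemma sigma_finite_P: "pair_sigma_finite P lborel"
  by unfold_locales

lemma cadlag_sample_path: "\<omega> \<in> space P \<Longrightarrow> cadlag (sample_path \<omega>)"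
  by (simp add: sample_path_def cadlag_paths)

lemma AE_contact_set:
  "AE \<omega> in P. cadlag (sample_path \<omega>) \<and> two_sided_closed (contact_set \<alpha> (sample_path \<omega>)) \<and> countable (contact_set \<alpha> (sample_path \<omega>))"
proof -
  \<comment> \<open>Any slope strictly between the drift and \<open>\<alpha>\<close> will do.\<close>
  define \<beta> where "\<beta> = (\<bar>expectation (X 1)\<bar> + \<alpha>) / 2"
  have \<beta>: "\<bar>expectation (X 1)\<bar> < \<beta>" "0 \<le> \<beta>" "\<beta> < \<alpha>" using drift by (auto simp: \<beta>_def)
  have "AE \<omega> in P. cadlag (sample_path \<omega>)" by (rule AE_I2) (rule cadlag_sample_path)
  then show ?thesis using linear_growth[OF integrable_X1 \<beta>(1)] discrete
  proof eventually_elim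
    case (elim \<omega>)
    then obtain K where "\<And>s. \<bar>sample_path \<omega> s\<bar> \<le> \<beta> * \<bar>s\<bar> + K" by (auto simp: sample_path_def)
    with elim(1) \<beta> have "two_sided_closed (contact_set \<alpha> (sample_path \<omega>))"
      by (intro two_sided_contact_set)
    with elim show ?case by (simp add: countable_if_closed_discrete closed_contact_set)
  qed
qed

text \<open>Joint measurability in \<open>\<omega>\<close> and the shift, as needed for Fubini's theorem.\<close>
lemma measurable_shift_pair:
  "(\<lambda>(\<omega>, u). shift_path u (sample_path \<omega>)) \<in> measurable (P \<Otimes>\<^sub>M lborel) path_space"
  "(\<lambda>(\<omega>, u). shift_path (- u) (sample_path \<omega>)) \<in> measurable (P \<Otimes>\<^sub>M lborel) path_space"
proof -
  have p: "(\<lambda>p. sample_path (fst p)) \<in> measurable (P \<Otimes>\<^sub>M lborel) path_space" by measurable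
  show "(\<lambda>(\<omega>, u). shift_path u (sample_path \<omega>)) \<in> measurable (P \<Otimes>\<^sub>M lborel) path_space"
    unfolding split_beta' by (rule measurable_shift[OF p]) measurable
  show "(\<lambda>(\<omega>, u). shift_path (- u) (sample_path \<omega>)) \<in> measurable (P \<Otimes>\<^sub>M lborel) path_space"
    unfolding split_beta' by (rule measurable_shift[OF p]) measurable
qed

text \<open>By stationarity the probability \<open>c\<close> of a contact at \<open>u\<close> does not depend on \<open>u\<close>. Integrated over
the unit interval it is the mean Lebesgue measure of the contact points in this interval, which
vanishes as the contact set is countable.\<close>
lemma AE_0_not_contact: "AE \<omega> in P. 0 \<notin> contact_set \<alpha> (sample_path \<omega>)"
proof -
  interpret PL: pair_sigma_finite P lborel by (rule sigma_finite_P)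
  define N where "N x = (indicator {x. 0 \<in> contact_set \<alpha> x} x :: ennreal)" for x :: "real \<Rightarrow> real"
  have pN: "Measurable.pred path_space (\<lambda>x. 0 \<in> contact_set \<alpha> x)"
    by (rule pred_contact_set) auto
  have N[measurable]: "N \<in> borel_measurable path_space"
    unfolding N_def using pN by (simp add: indicator_def[abs_def])
  define c where "c = (\<integral>\<^sup>+\<omega>. N (sample_path \<omega>) \<partial>P)"
  have [measurable]: "(\<lambda>(\<omega>, u). N (shift_path u (sample_path \<omega>))) \<in> borel_measurable (P \<Otimes>\<^sub>M lborel)"
    using measurable_compose[OF measurable_shift_pair(1) N] by (simp add: split_beta')
  have "c = (\<integral>\<^sup>+u. c * indicator {0..1::real} u \<partial>lborel)"
    by (subst nn_integral_cmult_indicator) auto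
  also have "\<dots> = (\<integral>\<^sup>+u. (\<integral>\<^sup>+\<omega>. N (shift_path u (sample_path \<omega>)) * indicator {0..1::real} u \<partial>P) \<partial>lborel)"
    using nn_integral_shift[OF N] by (simp add: nn_integral_multc c_def)
  also have "\<dots> = (\<integral>\<^sup>+\<omega>. (\<integral>\<^sup>+u. N (shift_path u (sample_path \<omega>)) * indicator {0..1::real} u \<partial>lborel) \<partial>P)"
    by (rule PL.Fubini') measurable
  also have "\<dots> = (\<integral>\<^sup>+\<omega>. 0 \<partial>P)"
  proof (rule nn_integral_cong_AE, use AE_contact_set in eventually_elim)
    case (elim \<omega>)
    then have "AE u in lborel. u \<notin> contact_set \<alpha> (sample_path \<omega>)"
      by (intro AE_not_in countable_imp_null_set_lborel) auto
    then have "AE u in lborel. N (shift_path u (sample_path \<omega>)) * indicator {0..1::real} u = 0"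
      by eventually_elim (use elim in \<open>simp add: N_def contact_set_shift\<close>)
    then have "(\<integral>\<^sup>+u. N (shift_path u (sample_path \<omega>)) * indicator {0..1::real} u \<partial>lborel) = (\<integral>\<^sup>+u. 0 \<partial>(lborel :: real measure))"
      by (rule nn_integral_cong_AE)
    then show ?case by simp
  qed
  finally have "c = 0" by simp
  then have "AE \<omega> in P. N (sample_path \<omega>) = 0"
    unfolding c_def by (subst (asm) nn_integral_0_iff_AE) measurable
  then show ?thesis by eventually_elim (simp add: N_def indicator_eq_0_iff)
qed

lemma AE_good:
  "AE \<omega> in P. cadlag (sample_path \<omega>) \<and> two_sided_closed (contact_set \<alpha> (sample_path \<omega>)) \<and>
     countable (contact_set \<alpha> (sample_path \<omega>)) \<and> 0 \<notin> contact_set \<alpha> (sample_path \<omega>)"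
  using AE_contact_set AE_0_not_contact by eventually_elim auto

text \<open>A functional of the gap around the origin. Invariance is required only for the paths and origins
that occur almost surely; elsewhere \<open>contact_G\<close> and \<open>contact_D\<close> need not bound a gap.\<close>
definition excursion_invariant :: "((real \<Rightarrow> real) \<Rightarrow> 'b) \<Rightarrow> bool" where
  "excursion_invariant F \<longleftrightarrow> (\<forall>x u. cadlag x \<longrightarrow> two_sided_closed (contact_set \<alpha> x) \<longrightarrow>
     0 \<notin> contact_set \<alpha> x \<longrightarrow> u \<notin> contact_set \<alpha> x \<longrightarrow> contact_G \<alpha> x < u \<longrightarrow> u < contact_D \<alpha> x \<longrightarrow>
     F (shift_path u x) = F x)"

text \<open>The kernel \<open>K x u\<close> is the mass density that the origin of the path \<open>x\<close> sends to the point \<open>u\<close> of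
its gap. The mass sent integrates to \<open>F 1\<^sub>A(D)\<close>. Shifting the origin to \<open>-u\<close> inside the expectation
turns it into the mass that the origin receives from \<open>-u\<close>, where the same \<open>F\<close> and \<open>\<zeta>\<close> are seen but
\<open>D\<close> is seen at distance \<open>D + u\<close>.\<close>
lemma mass_transport:
  fixes F :: "(real \<Rightarrow> real) \<Rightarrow> ennreal"
  assumes F[measurable]: "F \<in> borel_measurable path_space" and inv: "excursion_invariant F"
    and A[measurable]: "A \<in> sets borel" and A0: "A \<subseteq> {0<..}"
  shows "(\<integral>\<^sup>+\<omega>. F (sample_path \<omega>) * indicator A (contact_D \<alpha> (sample_path \<omega>)) \<partial>P) =
    (\<integral>\<^sup>+\<omega>. (\<integral>\<^sup>+r. F (sample_path \<omega>) * ennreal (1 / zeta_V \<alpha> (sample_path \<omega>)) * indicator (A \<inter> {..<zeta_V \<alpha> (sample_path \<omega>)}) r \<partial>lborel) \<partial>P)"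
proof -
  interpret PL: pair_sigma_finite P lborel by (rule sigma_finite_P)
  note [measurable] = measurable_contact_D[OF \<alpha>] measurable_contact_G[OF \<alpha>]
  define c where "c x = F x * ennreal (1 / zeta_V \<alpha> x)" for x
  have [measurable]: "c \<in> borel_measurable path_space" unfolding c_def zeta_V_def by measurable
  define K where "K x u = c x * indicator A (contact_D \<alpha> x) * indicator {contact_G \<alpha> x<..<contact_D \<alpha> x} u" for x u
  have K_eq: "K x u = c x * indicator A (contact_D \<alpha> x) * (if contact_G \<alpha> x < u \<and> u < contact_D \<alpha> x then 1 else 0)" for x u
    by (simp add: K_def indicator_def)
  have mK[measurable]: "(\<lambda>(x, u). K x u) \<in> borel_measurable (path_space \<Otimes>\<^sub>M lborel)"
    unfolding K_eq by measurable
  have mK1[measurable]: "(\<lambda>x. K x u) \<in> borel_measurable path_space" for u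
    unfolding K_eq by measurable
  have mK2[measurable]: "(\<lambda>(\<omega>, u). K (shift_path (- u) (sample_path \<omega>)) u) \<in> borel_measurable (P \<Otimes>\<^sub>M lborel)"
  proof -
    have "(\<lambda>p. (shift_path (- snd p) (sample_path (fst p)), snd p)) \<in> measurable (P \<Otimes>\<^sub>M lborel) (path_space \<Otimes>\<^sub>M lborel)"
      using measurable_shift_pair(2) by (intro measurable_Pair) (simp_all add: split_beta')
    from measurable_compose[OF this mK] show ?thesis by (simp add: split_beta')
  qed
  have "(\<integral>\<^sup>+\<omega>. F (sample_path \<omega>) * indicator A (contact_D \<alpha> (sample_path \<omega>)) \<partial>P) = (\<integral>\<^sup>+\<omega>. (\<integral>\<^sup>+u. K (sample_path \<omega>) u \<partial>lborel) \<partial>P)"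
  proof (rule nn_integral_cong_AE, use AE_good in eventually_elim)
    case (elim \<omega>)
    let ?x = "sample_path \<omega>"
    have GD: "contact_G \<alpha> ?x < 0" "0 < contact_D \<alpha> ?x"
      using elim prev_point(2)[of "contact_set \<alpha> ?x" 0] next_point(2)[of "contact_set \<alpha> ?x" 0] by (simp_all add: contact_GD_eq_points)
    then have "(\<integral>\<^sup>+u. K ?x u \<partial>lborel) = c ?x * indicator A (contact_D \<alpha> ?x) * ennreal (zeta_V \<alpha> ?x)"
      unfolding K_def by (subst nn_integral_cmult_indicator) (auto simp: zeta_V_def)
    also have "\<dots> = F ?x * (ennreal (1 / zeta_V \<alpha> ?x) * ennreal (zeta_V \<alpha> ?x)) * indicator A (contact_D \<alpha> ?x)"
      by (simp add: c_def ac_simps)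
    also have "ennreal (1 / zeta_V \<alpha> ?x) * ennreal (zeta_V \<alpha> ?x) = 1"
      using GD by (simp add: zeta_V_def flip: ennreal_mult)
    finally show ?case by simp
  qed
  also have "\<dots> = (\<integral>\<^sup>+u. (\<integral>\<^sup>+\<omega>. K (sample_path \<omega>) u \<partial>P) \<partial>lborel)"
    by (rule PL.Fubini'[symmetric]) measurable
  also have "\<dots> = (\<integral>\<^sup>+u. (\<integral>\<^sup>+\<omega>. K (shift_path (- u) (sample_path \<omega>)) u \<partial>P) \<partial>lborel)"
    by (intro nn_integral_cong nn_integral_shift[symmetric]) (rule mK1)
  also have "\<dots> = (\<integral>\<^sup>+\<omega>. (\<integral>\<^sup>+u. K (shift_path (- u) (sample_path \<omega>)) u \<partial>lborel) \<partial>P)"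
    by (rule PL.Fubini') (rule mK2)
  also have "\<dots> = (\<integral>\<^sup>+\<omega>. (\<integral>\<^sup>+r. c (sample_path \<omega>) * indicator (A \<inter> {..<zeta_V \<alpha> (sample_path \<omega>)}) r \<partial>lborel) \<partial>P)"
  proof (rule nn_integral_cong_AE, use AE_good AE_space in eventually_elim)
    case (elim \<omega>)
    define x where "x = sample_path \<omega>"
    have x: "cadlag x" "two_sided_closed (contact_set \<alpha> x)" "countable (contact_set \<alpha> x)" "0 \<notin> contact_set \<alpha> x"
      using elim by (auto simp: x_def)
    \<comment> \<open>Fix the path. The points \<open>u\<close> that send mass to the origin are, up to a null set, those of its own
      gap, and \<open>r = D - u\<close> runs through \<open>(0, \<zeta>)\<close>.\<close>
    let ?D = "contact_D \<alpha> x" and ?G = "contact_G \<alpha> x"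
    have m: "(\<lambda>u. K (shift_path (- u) x) u) \<in> borel_measurable borel"
      using measurable_compose[OF measurable_Pair1'[OF elim(2)] mK2] by (simp add: x_def)
    have "(\<integral>\<^sup>+u. K (shift_path (- u) x) u \<partial>lborel) = (\<integral>\<^sup>+u. K (shift_path u x) (- u) \<partial>lborel)"
      using nn_integral_real_affine[OF m, of "-1" 0] by simp
    also have "\<dots> = (\<integral>\<^sup>+u. c x * indicator (A \<inter> {..<zeta_V \<alpha> x}) (?D - u) \<partial>lborel)"
    proof (rule nn_integral_cong_AE)
      have "AE u in lborel. u \<notin> contact_set \<alpha> x"
        using x by (intro AE_not_in countable_imp_null_set_lborel) auto
      then show "AE u in lborel. K (shift_path u x) (- u) = c x * indicator (A \<inter> {..<zeta_V \<alpha> x}) (?D - u)"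
      proof eventually_elim
        case (elim u)
        note sym = gap_sym[OF x(1,2,4) elim]
        show ?case
        proof (cases "?G < u \<and> u < ?D")
          case True
          note V = process_V_shift[OF x(1,2,4) elim True[THEN conjunct1] True[THEN conjunct2]]
          have "F (shift_path u x) = F x" using inv x elim True unfolding excursion_invariant_def by blast
          then have "c (shift_path u x) = c x" by (simp add: c_def V)
          then show ?thesis using True sym by (simp add: K_eq V zeta_V_def indicator_def)
        next
          case False
          have "indicator (A \<inter> {..<zeta_V \<alpha> x}) (?D - u) = (0 :: ennreal)"
          proof (cases "u < ?D")
            case True
            with False show ?thesis by (simp add: zeta_V_def)
          next
            case False
            then have "?D - u \<notin> A" using A0 by auto
            then show ?thesis by simp
          qed
          then show ?thesis using False by (auto simp: K_eq sym)
        qed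
      qed
    qed
    also have "\<dots> = (\<integral>\<^sup>+r. c x * indicator (A \<inter> {..<zeta_V \<alpha> x}) r \<partial>lborel)"
      by (subst (2) nn_integral_real_affine[where c = "-1" and t = ?D]) auto
    finally show ?case by (simp add: x_def)
  qed
  finally show ?thesis by (simp add: c_def)
qed

end

section \<open>Density of the next contact time\<close>

text \<open>The fundamental theorem of calculus at a single point of right-continuity.\<close>
lemma right_derivative_tail_integral:
  fixes g :: "real \<Rightarrow> real"
  assumes int: "set_integrable lborel {a<..} g" and t: "a < t" and cont: "continuous (at_right t) g"
  shows "((\<lambda>s. LINT r:{s<..}|lborel. g r) has_real_derivative - g t) (at_right t)"
proof -
  have sub: "set_integrable lborel B g" if "B \<in> sets borel" "B \<subseteq> {a<..}" for B
    by (rule set_integrable_subset[OF int]) (use that in auto)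
  have meas: "set_borel_measurable lborel B g" if "B \<in> sets borel" "B \<subseteq> {a<..}" for B
    unfolding set_borel_measurable_def
    by (rule borel_measurable_integrable[OF sub[OF that, unfolded set_integrable_def]])
  have eq: "(LINT r:{s<..}|lborel. g r) = (LINT r:{t<..}|lborel. g r) - integral {t..s} g" if "t \<le> s" for s
  proof -
    have "(LINT r:{t<..}|lborel. g r) = (LINT r:{t<..s} \<union> {s<..}|lborel. g r)"
      using that by (simp add: ivl_disj_un)
    also have "\<dots> = (LINT r:{t<..s}|lborel. g r) + (LINT r:{s<..}|lborel. g r)"
      by (rule set_integral_Un) (use t that in \<open>auto intro!: sub\<close>)
    also have "(LINT r:{t<..s}|lborel. g r) = (LINT r:{t..s}|lborel. g r)"
    proof (rule set_integral_cong_set)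
      show "AE r in lborel. (r \<in> {t..s}) = (r \<in> {t<..s})"
        using AE_lborel_singleton[of t] by eventually_elim auto
      show "set_borel_measurable lborel {t<..s} g" by (rule meas) (use t in auto)
      show "set_borel_measurable lborel {t..s} g" by (rule meas) (use t in auto)
    qed
    also have "\<dots> = integral {t..s} g"
      using t by (intro set_borel_integral_eq_integral sub) auto
    finally show ?thesis by simp
  qed
  have "((\<lambda>u. integral {t..u} g) has_vector_derivative g t) (at t within ({t..t + 1} - {}))"
  proof (rule integral_has_vector_derivative_continuous_at)
    show "g integrable_on {t..t + 1}"
      using t by (intro set_borel_integral_eq_integral sub) auto
    show "continuous (at t within ({t..t + 1} - {})) g"
      using cont by (simp add: at_within_Icc_at_right)
  qed auto
  then have "((\<lambda>u. integral {t..u} g) has_real_derivative g t) (at_right t)"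
    by (simp add: has_real_derivative_iff_has_vector_derivative at_within_Icc_at_right)
  from DERIV_diff[OF DERIV_const[of "LINT r:{t<..}|lborel. g r"] this]
  have d: "((\<lambda>u. (LINT r:{t<..}|lborel. g r) - integral {t..u} g) has_real_derivative - g t) (at_right t)"
    by simp
  show ?thesis
  proof (rule has_field_derivative_cong_eventually[THEN iffD1, OF _ _ d])
    show "\<forall>\<^sub>F s in at_right t. (LINT r:{t<..}|lborel. g r) - integral {t..s} g = (LINT r:{s<..}|lborel. g r)"
      unfolding eventually_at_filter by (intro always_eventually allI impI eq[symmetric]) simp
    show "(LINT r:{t<..}|lborel. g r) - integral {t..t} g = (LINT r:{t<..}|lborel. g r)" by simp
  qed
qed

context levy_contact
begin

text \<open>By mass transport this is the density at \<open>r\<close> of the measure \<open>A \<mapsto> E[Y; D \<in> A]\<close>.\<close>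
definition gap_density :: "((real \<Rightarrow> real) \<Rightarrow> real) \<Rightarrow> real \<Rightarrow> real" where
  "gap_density Y r = expectation (\<lambda>\<omega>. Y (sample_path \<omega>) / zeta_V \<alpha> (sample_path \<omega>) * indicator {r<..} (zeta_V \<alpha> (sample_path \<omega>)))"

text \<open>Positive and negative parts are transported separately, and the identity for \<open>|Y|\<close> provides the
integrability that Fubini's theorem asks for.\<close>
lemma mass_transport_real:
  fixes Y :: "(real \<Rightarrow> real) \<Rightarrow> real"
  assumes Y[measurable]: "Y \<in> borel_measurable path_space" and inv: "excursion_invariant Y"
    and bound: "\<And>x. \<bar>Y x\<bar> \<le> B"
    and A[measurable]: "A \<in> sets borel" and A0: "A \<subseteq> {0<..}"
  shows "set_integrable lborel A (gap_density Y)"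
    and "expectation (\<lambda>\<omega>. Y (sample_path \<omega>) * indicator A (contact_D \<alpha> (sample_path \<omega>))) = (LINT r:A|lborel. gap_density Y r)"
    and "expectation (\<lambda>\<omega>. Y (sample_path \<omega>) * indicator A (contact_D \<alpha> (sample_path \<omega>))) =
      expectation (\<lambda>\<omega>. Y (sample_path \<omega>) / zeta_V \<alpha> (sample_path \<omega>) * measure lborel (A \<inter> {..<zeta_V \<alpha> (sample_path \<omega>)}))"
proof -
  interpret PL: pair_sigma_finite P lborel by (rule sigma_finite_P)
  note [measurable] = measurable_contact_D[OF \<alpha>] measurable_contact_G[OF \<alpha>]
  let ?\<zeta> = "\<lambda>\<omega>. zeta_V \<alpha> (sample_path \<omega>)" and ?D = "\<lambda>\<omega>. contact_D \<alpha> (sample_path \<omega>)"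
  have [measurable]: "zeta_V \<alpha> \<in> borel_measurable path_space"
    unfolding zeta_V_def[abs_def] by measurable
  define H where "H \<omega> r = Y (sample_path \<omega>) / ?\<zeta> \<omega> * indicator (A \<inter> {..<?\<zeta> \<omega>}) r" for \<omega> r
  have H_eq: "H \<omega> r = Y (sample_path \<omega>) / ?\<zeta> \<omega> * (if r \<in> A \<and> r < ?\<zeta> \<omega> then 1 else 0)" for \<omega> r
    by (simp add: H_def indicator_def)
  have mH[measurable]: "(\<lambda>(\<omega>, r). H \<omega> r) \<in> borel_measurable (P \<Otimes>\<^sub>M lborel)"
    unfolding H_eq by measurable
  have transport: "(\<integral>\<^sup>+\<omega>. ennreal (G (sample_path \<omega>) * indicator A (?D \<omega>)) \<partial>P) =
      (\<integral>\<^sup>+p. ennreal (case p of (\<omega>, r) \<Rightarrow> G (sample_path \<omega>) / ?\<zeta> \<omega> * indicator (A \<inter> {..<?\<zeta> \<omega>}) r) \<partial>(P \<Otimes>\<^sub>M lborel))"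
    if [measurable]: "G \<in> borel_measurable path_space" and G: "excursion_invariant G" for G :: "(real \<Rightarrow> real) \<Rightarrow> real"
  proof -
    have m: "(\<lambda>p. ennreal (case p of (\<omega>, r) \<Rightarrow> G (sample_path \<omega>) / ?\<zeta> \<omega> * indicator (A \<inter> {..<?\<zeta> \<omega>}) r)) \<in> borel_measurable (P \<Otimes>\<^sub>M lborel)"
    proof -
      have "(\<lambda>(\<omega>, r). G (sample_path \<omega>) / ?\<zeta> \<omega> * (if r \<in> A \<and> r < ?\<zeta> \<omega> then 1 else 0)) \<in> borel_measurable (P \<Otimes>\<^sub>M lborel)"
        by measurable
      then show ?thesis by (simp add: indicator_def of_bool_def)
    qed
    have "(\<integral>\<^sup>+\<omega>. ennreal (G (sample_path \<omega>) * indicator A (?D \<omega>)) \<partial>P) = (\<integral>\<^sup>+\<omega>. ennreal (G (sample_path \<omega>)) * indicator A (?D \<omega>) \<partial>P)"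
      by (intro nn_integral_cong) (auto simp: indicator_def)
    also have "\<dots> = (\<integral>\<^sup>+\<omega>. (\<integral>\<^sup>+r. ennreal (G (sample_path \<omega>)) * ennreal (1 / ?\<zeta> \<omega>) * indicator (A \<inter> {..<?\<zeta> \<omega>}) r \<partial>lborel) \<partial>P)"
      using G by (intro mass_transport A A0) (auto simp: excursion_invariant_def)
    also have "\<dots> = (\<integral>\<^sup>+\<omega>. (\<integral>\<^sup>+r. ennreal (G (sample_path \<omega>) / ?\<zeta> \<omega> * indicator (A \<inter> {..<?\<zeta> \<omega>}) r) \<partial>lborel) \<partial>P)"
    proof (intro nn_integral_cong)
      fix \<omega> and r :: real
      \<comment> \<open>Where the indicator does not vanish, \<open>A \<subseteq> {0<..}\<close> forces \<open>\<zeta> > 0\<close>.\<close>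
      show "ennreal (G (sample_path \<omega>)) * ennreal (1 / ?\<zeta> \<omega>) * indicator (A \<inter> {..<?\<zeta> \<omega>}) r
          = ennreal (G (sample_path \<omega>) / ?\<zeta> \<omega> * indicator (A \<inter> {..<?\<zeta> \<omega>}) r)"
      proof (cases "r \<in> A \<inter> {..<?\<zeta> \<omega>}")
        case True
        then have "0 < r" "r < ?\<zeta> \<omega>" using A0 by auto
        then have "0 \<le> 1 / ?\<zeta> \<omega>" by simp
        from ennreal_mult''[OF this, of "G (sample_path \<omega>)"] show ?thesis using True by simp
      qed simp
    qed
    also have "\<dots> = (\<integral>\<^sup>+p. ennreal (case p of (\<omega>, r) \<Rightarrow> G (sample_path \<omega>) / ?\<zeta> \<omega> * indicator (A \<inter> {..<?\<zeta> \<omega>}) r) \<partial>(P \<Otimes>\<^sub>M lborel))"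
      using lborel.nn_integral_fst[OF m] by simp
    finally show ?thesis .
  qed
  have intY: "integrable P (\<lambda>\<omega>. Y (sample_path \<omega>) * indicator A (?D \<omega>))"
    by (rule integrable_const_bound[where B = B])
       (use bound in \<open>auto simp: indicator_def intro: order_trans[OF abs_ge_zero]\<close>)
  have invs: "excursion_invariant (\<lambda>x. \<bar>Y x\<bar>)" "excursion_invariant (\<lambda>x. - Y x)"
    using inv by (simp_all add: excursion_invariant_def)
  have intH: "integrable (P \<Otimes>\<^sub>M lborel) (\<lambda>(\<omega>, r). H \<omega> r)"
  proof (rule integrableI_bounded)
    have "(\<integral>\<^sup>+p. ennreal (norm (case p of (\<omega>, r) \<Rightarrow> H \<omega> r)) \<partial>(P \<Otimes>\<^sub>M lborel))
      = (\<integral>\<^sup>+p. ennreal (case p of (\<omega>, r) \<Rightarrow> \<bar>Y (sample_path \<omega>)\<bar> / ?\<zeta> \<omega> * indicator (A \<inter> {..<?\<zeta> \<omega>}) r) \<partial>(P \<Otimes>\<^sub>M lborel))"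
      using A0 by (intro nn_integral_cong) (auto simp: H_def indicator_def abs_mult)
    also have "\<dots> = (\<integral>\<^sup>+\<omega>. ennreal (\<bar>Y (sample_path \<omega>)\<bar> * indicator A (?D \<omega>)) \<partial>P)"
      by (rule transport[symmetric]) (use invs in measurable)
    also have "\<dots> = (\<integral>\<^sup>+\<omega>. ennreal (norm (Y (sample_path \<omega>) * indicator A (?D \<omega>))) \<partial>P)"
      by (intro nn_integral_cong) (auto simp: indicator_def)
    also have "\<dots> < \<infinity>" using intY by (simp only: integrable_iff_bounded)
    finally show "(\<integral>\<^sup>+p. ennreal (norm (case p of (\<omega>, r) \<Rightarrow> H \<omega> r)) \<partial>(P \<Otimes>\<^sub>M lborel)) < \<infinity>" .
  qed measurable
  have EH: "expectation (\<lambda>\<omega>. Y (sample_path \<omega>) * indicator A (?D \<omega>)) = integral\<^sup>L (P \<Otimes>\<^sub>M lborel) (\<lambda>(\<omega>, r). H \<omega> r)"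
  proof -
    have "(\<integral>\<^sup>+\<omega>. ennreal (- (Y (sample_path \<omega>) * indicator A (?D \<omega>))) \<partial>P) =
          (\<integral>\<^sup>+p. ennreal (- (case p of (\<omega>, r) \<Rightarrow> H \<omega> r)) \<partial>(P \<Otimes>\<^sub>M lborel))"
      using transport[of "\<lambda>x. - Y x"] invs by (simp add: H_def split_beta')
    moreover have "(\<integral>\<^sup>+\<omega>. ennreal (Y (sample_path \<omega>) * indicator A (?D \<omega>)) \<partial>P) =
          (\<integral>\<^sup>+p. ennreal (case p of (\<omega>, r) \<Rightarrow> H \<omega> r) \<partial>(P \<Otimes>\<^sub>M lborel))"
      using transport[of Y] inv by (simp add: H_def)
    ultimately show ?thesis
      unfolding real_lebesgue_integral_def[OF intY] real_lebesgue_integral_def[OF intH] by simp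
  qed
  have g: "(\<integral>\<omega>. H \<omega> r \<partial>P) = indicator A r * gap_density Y r" for r
    by (simp add: gap_density_def H_def indicator_inter_arith ac_simps)
       (auto simp: indicator_def cong: if_cong)
  show "set_integrable lborel A (gap_density Y)"
    using PL.integrable_snd[OF intH] by (simp add: g set_integrable_def)
  show "expectation (\<lambda>\<omega>. Y (sample_path \<omega>) * indicator A (?D \<omega>)) = (LINT r:A|lborel. gap_density Y r)"
    unfolding EH PL.integral_snd[OF intH, symmetric] g by (simp add: set_lebesgue_integral_def)
  have "(\<integral>r. H \<omega> r \<partial>lborel) = Y (sample_path \<omega>) / ?\<zeta> \<omega> * measure lborel (A \<inter> {..<?\<zeta> \<omega>})" for \<omega>
    by (simp add: H_def)
  then show "expectation (\<lambda>\<omega>. Y (sample_path \<omega>) * indicator A (?D \<omega>)) =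
      expectation (\<lambda>\<omega>. Y (sample_path \<omega>) / ?\<zeta> \<omega> * measure lborel (A \<inter> {..<?\<zeta> \<omega>}))"
    unfolding EH PL.integral_fst[OF intH, symmetric] by simp
qed

text \<open>Dominated convergence; the factor \<open>1 / \<zeta>\<close> is bounded by \<open>1 / t\<close> on gaps longer than \<open>t\<close>.\<close>
lemma gap_density_right_continuous:
  assumes Y[measurable]: "Y \<in> borel_measurable path_space" and bound: "\<And>x. \<bar>Y x\<bar> \<le> B" and t: "0 < t"
  shows "continuous (at_right t) (gap_density Y)"
  unfolding continuous_within
proof (rule tendsto_at_right_sequentially[of t "t + 1"])
  note [measurable] = measurable_contact_D[OF \<alpha>] measurable_contact_G[OF \<alpha>]
  have [measurable]: "zeta_V \<alpha> \<in> borel_measurable path_space"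
    unfolding zeta_V_def[abs_def] by measurable
  have "0 \<le> B" using bound[of undefined] by simp
  fix S :: "nat \<Rightarrow> real" assume S: "\<And>n. t < S n" "S \<longlonglongrightarrow> t"
  show "(\<lambda>n. gap_density Y (S n)) \<longlonglongrightarrow> gap_density Y t"
    unfolding gap_density_def
  proof (rule integral_dominated_convergence[where w = "\<lambda>_. B / t"])
    show "AE \<omega> in P. (\<lambda>n. Y (sample_path \<omega>) / zeta_V \<alpha> (sample_path \<omega>) * indicator {S n<..} (zeta_V \<alpha> (sample_path \<omega>)))
        \<longlonglongrightarrow> Y (sample_path \<omega>) / zeta_V \<alpha> (sample_path \<omega>) * indicator {t<..} (zeta_V \<alpha> (sample_path \<omega>))"
    proof (intro AE_I2 tendsto_mult tendsto_const)
      fix \<omega>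
      let ?z = "zeta_V \<alpha> (sample_path \<omega>)"
      show "(\<lambda>n. indicator {S n<..} ?z) \<longlonglongrightarrow> (indicator {t<..} ?z :: real)"
      proof (cases "t < ?z")
        case True
        have "\<forall>\<^sub>F n in sequentially. S n < ?z" by (rule order_tendstoD(2)[OF S(2) True])
        then have "\<forall>\<^sub>F n in sequentially. indicator {S n<..} ?z = (indicator {t<..} ?z :: real)"
          by eventually_elim (use True in simp)
        then show ?thesis by (rule tendsto_eventually)
      next
        case False
        then have "indicator {S n<..} ?z = (0 :: real)" for n using S(1)[of n] by simp
        then show ?thesis using False by simp
      qed
    qed
    show "AE \<omega> in P. norm (Y (sample_path \<omega>) / zeta_V \<alpha> (sample_path \<omega>) * indicator {S n<..} (zeta_V \<alpha> (sample_path \<omega>))) \<le> B / t" for n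
    proof (intro AE_I2)
      fix \<omega>
      show "norm (Y (sample_path \<omega>) / zeta_V \<alpha> (sample_path \<omega>) * indicator {S n<..} (zeta_V \<alpha> (sample_path \<omega>))) \<le> B / t"
        using bound[of "sample_path \<omega>"] S(1)[of n] t \<open>0 \<le> B\<close>
        by (auto simp: indicator_def abs_divide intro!: frac_le)
    qed
  qed auto
qed auto

text \<open>On \<open>{t < \<zeta>}\<close> write \<open>Y = Y (\<zeta> - t) / \<zeta> + t Y / \<zeta>\<close>. The mean of the first term is that of \<open>Y\<close> on
\<open>{t < D}\<close>, by mass transport for \<open>A = (t, \<infinity>)\<close>.\<close>
lemma expectation_long_gap:
  assumes Y[measurable]: "Y \<in> borel_measurable path_space" and inv: "excursion_invariant Y"
    and bound: "\<And>x. \<bar>Y x\<bar> \<le> B" and t: "0 < t"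
  shows "expectation (\<lambda>\<omega>. Y (sample_path \<omega>) * indicator {t<..} (zeta_V \<alpha> (sample_path \<omega>))) =
    expectation (\<lambda>\<omega>. Y (sample_path \<omega>) * indicator {t<..} (contact_D \<alpha> (sample_path \<omega>))) + t * gap_density Y t"
proof -
  note [measurable] = measurable_contact_D[OF \<alpha>] measurable_contact_G[OF \<alpha>]
  have [measurable]: "zeta_V \<alpha> \<in> borel_measurable path_space"
    unfolding zeta_V_def[abs_def] by measurable
  have "0 \<le> B" using bound[of undefined] by simp
  let ?\<zeta> = "\<lambda>\<omega>. zeta_V \<alpha> (sample_path \<omega>)"
  have int1: "integrable P (\<lambda>\<omega>. Y (sample_path \<omega>) * indicator {t<..} (?\<zeta> \<omega>))"
    by (rule integrable_const_bound[where B = B])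
       (use bound \<open>0 \<le> B\<close> in \<open>auto simp: indicator_def\<close>)
  have int2: "integrable P (\<lambda>\<omega>. Y (sample_path \<omega>) / ?\<zeta> \<omega> * indicator {t<..} (?\<zeta> \<omega>))"
    by (rule integrable_const_bound[where B = "B / t"])
       (use bound \<open>0 \<le> B\<close> t in \<open>auto simp: indicator_def abs_divide intro!: frac_le AE_I2\<close>)
  have "expectation (\<lambda>\<omega>. Y (sample_path \<omega>) * indicator {t<..} (contact_D \<alpha> (sample_path \<omega>))) =
      expectation (\<lambda>\<omega>. Y (sample_path \<omega>) / ?\<zeta> \<omega> * measure lborel ({t<..} \<inter> {..<?\<zeta> \<omega>}))"
    by (rule mass_transport_real(3)[OF Y inv bound]) (use t in auto)
  also have "\<dots> = expectation (\<lambda>\<omega>. Y (sample_path \<omega>) * indicator {t<..} (?\<zeta> \<omega>)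
      - t * (Y (sample_path \<omega>) / ?\<zeta> \<omega> * indicator {t<..} (?\<zeta> \<omega>)))"
  proof (rule Bochner_Integration.integral_cong[OF refl])
    fix \<omega>
    have "{t<..} \<inter> {..<?\<zeta> \<omega>} = {t<..<?\<zeta> \<omega>}" by auto
    then show "Y (sample_path \<omega>) / ?\<zeta> \<omega> * measure lborel ({t<..} \<inter> {..<?\<zeta> \<omega>}) =
       Y (sample_path \<omega>) * indicator {t<..} (?\<zeta> \<omega>) - t * (Y (sample_path \<omega>) / ?\<zeta> \<omega> * indicator {t<..} (?\<zeta> \<omega>))"
      using t by (cases "t < ?\<zeta> \<omega>") (auto simp: field_simps)
  qed
  also have "\<dots> = expectation (\<lambda>\<omega>. Y (sample_path \<omega>) * indicator {t<..} (?\<zeta> \<omega>)) - t * gap_density Y t"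
    unfolding gap_density_def
    using Bochner_Integration.integral_diff[OF int1 integrable_mult_right[OF int2, of t]]
    by (simp only: integral_mult_right_zero)
  finally show ?thesis by simp
qed

end

theorem corollary4p8:
  fixes P :: "'a measure" and X :: "real \<Rightarrow> 'a \<Rightarrow> real" and \<alpha> :: real
    and n :: nat and f :: "nat \<Rightarrow> real option \<Rightarrow> real" and \<tau> :: "nat \<Rightarrow> real"
  defines "xpath \<equiv> (\<lambda>\<omega> t. X t \<omega>)"
  defines "V \<equiv> (\<lambda>t \<omega>. process_V \<alpha> (xpath \<omega>) t)"
    and "W \<equiv> (\<lambda>t \<omega>. process_W \<alpha> (xpath \<omega>) t)"
    and "\<zeta>V \<equiv> (\<lambda>\<omega>. zeta_V \<alpha> (xpath \<omega>))"
    and "\<zeta>W \<equiv> (\<lambda>\<omega>. zeta_W \<alpha> (xpath \<omega>))"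
  assumes "\<alpha> > 0"
    and "two_sided_levy_process P X"
    and "\<not> (\<exists>a. AE \<omega> in P. \<forall>t. X t \<omega> = a * t)"
    and "integrable P (X 1)"
    and "\<bar>prob_space.expectation P (X 1)\<bar> < \<alpha>"
    and "AE \<omega> in P. topological_space_class.discrete (contact_set \<alpha> (xpath \<omega>))"
    and "n \<ge> 1"
    and "\<And>i. i \<in> {1..n} \<Longrightarrow> f i \<in> borel_measurable borel_cemetery"
    and "\<And>i. i \<in> {1..n} \<Longrightarrow> bounded (range (f i))"
    and "\<And>i. i \<in> {1..n} \<Longrightarrow> f i None = 0"
    and "0 \<le> \<tau> 1"
    and "strict_mono_on {1..n} \<tau>"
  shows "\<exists>g. right_cont_density_on
        (\<lambda>A. prob_space.expectation P
               (\<lambda>\<omega>. (\<Prod>i=1..n. f i (W (\<tau> i) \<omega>)) * indicator A (\<zeta>W \<omega>))) (\<tau> n) g \<and>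
      (\<forall>t>\<tau> n.
         ((\<lambda>s. prob_space.expectation P
                 (\<lambda>\<omega>. (\<Prod>i=1..n. f i (W (\<tau> i) \<omega>)) * indicator {s<..} (\<zeta>W \<omega>)))
            has_real_derivative - g t) (at_right t) \<and>
         prob_space.expectation P
             (\<lambda>\<omega>. (\<Prod>i=1..n. f i (V (\<tau> i) \<omega>)) * indicator {t<..} (\<zeta>V \<omega>))
           = prob_space.expectation P
               (\<lambda>\<omega>. (\<Prod>i=1..n. f i (W (\<tau> i) \<omega>)) * indicator {t<..} (\<zeta>W \<omega>))
             + t * g t)"
proof -
  interpret two_sided_levy_process P X by fact
  have xpath: "xpath = sample_path" by (simp add: xpath_def sample_path_def fun_eq_iff)
  interpret levy_contact P X \<alpha>
    by unfold_locales (use assms(6,9-11) in \<open>simp_all add: xpath\<close>)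
  have \<tau>: "0 \<le> \<tau> n" "\<And>i. i \<in> {1..n} \<Longrightarrow> \<tau> i \<le> \<tau> n"
  proof -
    show le: "\<tau> i \<le> \<tau> n" if "i \<in> {1..n}" for i
      using strict_mono_onD[OF \<open>strict_mono_on {1..n} \<tau>\<close>, of i n] that by (cases "i = n") auto
    show "0 \<le> \<tau> n" using \<open>0 \<le> \<tau> 1\<close> le[of 1] \<open>n \<ge> 1\<close> by simp
  qed
  define Y where "Y x = (\<Prod>i=1..n. f i (process_V \<alpha> x (\<tau> i)))" for x
  have Y: "Y \<in> borel_measurable path_space"
    unfolding Y_def by (intro borel_measurable_prod measurable_process_V \<alpha> assms(13))
  have inv: "excursion_invariant Y"
    by (auto simp: excursion_invariant_def Y_def process_V_shift(4))
  have "\<exists>b. \<forall>v. \<bar>f i v\<bar> \<le> b" if "i \<in> {1..n}" for i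
    using assms(14)[OF that] by (auto simp: bounded_iff)
  then obtain b where b: "\<And>i v. i \<in> {1..n} \<Longrightarrow> \<bar>f i v\<bar> \<le> b i" by metis
  define B where "B = (\<Prod>i=1..n. b i)"
  have bound: "\<bar>Y x\<bar> \<le> B" for x
    unfolding Y_def B_def abs_prod by (intro prod_mono) (use b in auto)
  define g where "g = gap_density Y"
  \<comment> \<open>If \<open>D > \<tau> n\<close>, killing at \<open>D\<close> has no effect at the observation times.\<close>
  have W_eq: "(\<Prod>i=1..n. f i (W (\<tau> i) \<omega>)) * indicator A (\<zeta>W \<omega>) = Y (sample_path \<omega>) * indicator A (contact_D \<alpha> (sample_path \<omega>))"
    if "A \<subseteq> {\<tau> n<..}" for A \<omega>
  proof (cases "contact_D \<alpha> (sample_path \<omega>) \<in> A")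
    case True
    then have "\<tau> n < zeta_W \<alpha> (sample_path \<omega>)" using that by (auto simp: zeta_W_def)
    then have "W (\<tau> i) \<omega> = process_V \<alpha> (sample_path \<omega>) (\<tau> i)" if "i \<in> {1..n}" for i
      using \<tau>(2)[OF that] by (simp add: W_def xpath process_W_def)
    then show ?thesis by (simp add: Y_def \<zeta>W_def xpath zeta_W_def)
  qed (simp add: \<zeta>W_def xpath zeta_W_def)
  have sub0: "A \<subseteq> {0<..}" if "A \<subseteq> {\<tau> n<..}" for A using that \<tau>(1) by auto
  have V_eq: "(\<Prod>i=1..n. f i (V (\<tau> i) \<omega>)) = Y (sample_path \<omega>)" for \<omega> by (simp add: V_def xpath Y_def)
  have W_tail: "expectation (\<lambda>\<omega>. (\<Prod>i=1..n. f i (W (\<tau> i) \<omega>)) * indicator A (\<zeta>W \<omega>)) = (LINT r:A|lborel. g r)"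
    if "A \<in> sets borel" "A \<subseteq> {\<tau> n<..}" for A
    unfolding W_eq[OF that(2)] g_def
    by (rule mass_transport_real(2)[OF Y inv bound that(1) sub0[OF that(2)]])
  have g_int: "set_integrable lborel {\<tau> n<..} g"
    unfolding g_def by (rule mass_transport_real(1)[OF Y inv bound]) (use sub0 in auto)
  have g_cont: "continuous (at_right t) g" if "\<tau> n < t" for t
    unfolding g_def using \<tau>(1) that by (intro gap_density_right_continuous[OF Y bound]) simp
  have "right_cont_density_on (\<lambda>A. expectation (\<lambda>\<omega>. (\<Prod>i=1..n. f i (W (\<tau> i) \<omega>)) * indicator A (\<zeta>W \<omega>))) (\<tau> n) g"
    unfolding right_cont_density_on_def using g_int g_cont W_tail by blast
  moreover have "((\<lambda>s. expectation (\<lambda>\<omega>. (\<Prod>i=1..n. f i (W (\<tau> i) \<omega>)) * indicator {s<..} (\<zeta>W \<omega>)))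
            has_real_derivative - g t) (at_right t)" if t: "\<tau> n < t" for t
  proof (rule has_field_derivative_cong_eventually[THEN iffD1, OF _ _ right_derivative_tail_integral[OF g_int t g_cont[OF t]]])
    have eq: "(LINT r:{s<..}|lborel. g r) = expectation (\<lambda>\<omega>. (\<Prod>i=1..n. f i (W (\<tau> i) \<omega>)) * indicator {s<..} (\<zeta>W \<omega>))"
      if "t \<le> s" for s
      by (rule W_tail[symmetric]) (use t that in auto)
    show "\<forall>\<^sub>F s in at_right t. (LINT r:{s<..}|lborel. g r) =
        expectation (\<lambda>\<omega>. (\<Prod>i=1..n. f i (W (\<tau> i) \<omega>)) * indicator {s<..} (\<zeta>W \<omega>))"
      unfolding eventually_at_filter by (intro always_eventually allI impI eq) simp
    show "(LINT r:{t<..}|lborel. g r) =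
        expectation (\<lambda>\<omega>. (\<Prod>i=1..n. f i (W (\<tau> i) \<omega>)) * indicator {t<..} (\<zeta>W \<omega>))"
      by (rule eq) simp
  qed
  moreover have "expectation (\<lambda>\<omega>. (\<Prod>i=1..n. f i (V (\<tau> i) \<omega>)) * indicator {t<..} (\<zeta>V \<omega>))
      = expectation (\<lambda>\<omega>. (\<Prod>i=1..n. f i (W (\<tau> i) \<omega>)) * indicator {t<..} (\<zeta>W \<omega>)) + t * g t"
    if t: "\<tau> n < t" for t
  proof -
    have "{t<..} \<subseteq> {\<tau> n<..}" using t by auto
    then show ?thesis
      using expectation_long_gap[OF Y inv bound, of t] \<tau>(1) t
      by (simp only: W_eq V_eq) (simp add: \<zeta>V_def xpath g_def)
  qed
  ultimately show ?thesis by blast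
qed

end
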